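(* Let $(M,g)$ be a connected geodesic orbit Riemannian manifold (GO-manifold), and let $\mathfrak{g}$ be its Lie algebra of Killing fields. Suppose that $\mathfrak{a}$ is an abelian ideal of $\mathfrak{g}$. Then every Killing field $X\in\mathfrak{a}$ has constant length on $(M,g)$, i.e. the function $y\in M\mapsto g_y(X,X)$ is constant on $M$.
   Context: A Riemannian manifold $(M,g)$ is called a geodesic orbit manifold (GO-manifold) if every geodesic of $(M,g)$ is (as a set) an orbit of a 1-parameter subgroup of the full isometry group of $(M,g)$. The Lie algebra of the full isometry group of $(M,g)$ is identified with the Lie algebra $\mathfrak{g}$ of Killing vector fields on $(M,g)$. The notation $g_y(X,Y)$ means $g_y(X(y),Y(y))$. *)

theory Defs
  imports "HOL-Analysis.Analysis" "HOL-Library.Function_Algebras"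
begin

text \<open>
  Pointwise scalar multiplication on functions. It makes tangent vectors and vector fields, which
  are functions below, elements of a real vector space, so that \<open>subspace\<close> applies to sets of them.
\<close>

instantiation "fun" :: (type, scaleR) scaleR
begin

definition scaleR_fun :: "real \<Rightarrow> ('a \<Rightarrow> 'b) \<Rightarrow> 'a \<Rightarrow> 'b"
  where "scaleR_fun r f = (\<lambda>x. r *\<^sub>R f x)"

instance ..

end

instance "fun" :: (type, real_vector) real_vector
  by standard (simp_all add: scaleR_fun_def plus_fun_def scaleR_add_left scaleR_add_right)


section \<open>Smooth functions between normed spaces\<close>

text \<open>Both notions are meant for open domains \<open>S\<close> in finite-dimensional spaces.\<close>

primrec Ck_on :: "nat \<Rightarrow> 'a::real_normed_vector set \<Rightarrow> ('a \<Rightarrow> 'b::real_normed_vector) \<Rightarrow> bool"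
  where
    "Ck_on 0 S f \<longleftrightarrow> continuous_on S f"
  | "Ck_on (Suc k) S f \<longleftrightarrow>
       (\<forall>x\<in>S. f differentiable (at x)) \<and>
       (\<forall>v. Ck_on k S (\<lambda>x. frechet_derivative f (at x) v))"

definition smooth_on :: "'a::real_normed_vector set \<Rightarrow> ('a \<Rightarrow> 'b::real_normed_vector) \<Rightarrow> bool"
  where "smooth_on S f \<longleftrightarrow> (\<forall>k. Ck_on k S f)"


section \<open>Smooth manifolds\<close>

text \<open>
  A manifold is a Hausdorff second countable type together with a smooth atlas. The atlas need not
  be maximal. The map of a chart is only relevant on the domain of the chart.
\<close>

datatype ('m, 'e) chart = Chart (chart_dom: "'m set") (chart_map: "'m \<Rightarrow> 'e")

definition chart_image :: "('m, 'e) chart \<Rightarrow> 'e set"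
  where "chart_image c = chart_map c ` chart_dom c"

definition chart_inv :: "('m, 'e) chart \<Rightarrow> 'e \<Rightarrow> 'm"
  where "chart_inv c = inv_into (chart_dom c) (chart_map c)"

definition is_chart :: "('m::topological_space, 'e::euclidean_space) chart \<Rightarrow> bool"
  where "is_chart c \<longleftrightarrow>
    open (chart_dom c) \<and> open (chart_image c) \<and>
    homeomorphism (chart_dom c) (chart_image c) (chart_map c) (chart_inv c)"

definition smooth_atlas ::
  "('m::{t2_space, second_countable_topology}, 'e::euclidean_space) chart set \<Rightarrow> bool"
  where "smooth_atlas A \<longleftrightarrow>
    (\<forall>c\<in>A. is_chart c) \<and>
    (\<Union>c\<in>A. chart_dom c) = UNIV \<and>
    (\<forall>c\<in>A. \<forall>d\<in>A.
       smooth_on (chart_map c ` (chart_dom c \<inter> chart_dom d)) (chart_map d \<circ> chart_inv c))"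

definition smooth_map ::
  "('m::topological_space, 'e::euclidean_space) chart set \<Rightarrow>
   ('n::topological_space, 'f::euclidean_space) chart set \<Rightarrow> ('m \<Rightarrow> 'n) \<Rightarrow> bool"
  where "smooth_map A B f \<longleftrightarrow>
    continuous_on UNIV f \<and>
    (\<forall>c\<in>A. \<forall>d\<in>B.
       smooth_on (chart_map c ` (chart_dom c \<inter> f -` chart_dom d))
         (chart_map d \<circ> f \<circ> chart_inv c))"

text \<open>The product atlas on \<open>\<real> \<times> M\<close>.\<close>

definition time_atlas :: "('m, 'e) chart set \<Rightarrow> (real \<times> 'm, real \<times> 'e) chart set"
  where "time_atlas A =
    (\<lambda>c. Chart (UNIV \<times> chart_dom c) (\<lambda>(t, p). (t, chart_map c p))) ` A"


section \<open>Tangent vectors and vector fields\<close>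

text \<open>
  A tangent vector at \<open>p\<close> is the family of its coordinate vectors with respect to all charts of the
  atlas around \<open>p\<close>, subject to the usual transformation rule. At charts that are not around \<open>p\<close>
  the family is \<open>0\<close>, so that equality of tangent vectors is equality of functions.
\<close>

type_synonym ('m, 'e) tvec = "('m, 'e) chart \<Rightarrow> 'e"

definition tangent_space ::
  "('m::topological_space, 'e::euclidean_space) chart set \<Rightarrow> 'm \<Rightarrow> ('m, 'e) tvec set"
  where "tangent_space A p =
    {v. (\<forall>c. c \<notin> A \<or> p \<notin> chart_dom c \<longrightarrow> v c = 0) \<and>
        (\<forall>c\<in>A. \<forall>d\<in>A. p \<in> chart_dom c \<inter> chart_dom d \<longrightarrow>
           v d = frechet_derivative (chart_map d \<circ> chart_inv c) (at (chart_map c p)) (v c))}"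

text \<open>The tangent vector at \<open>p\<close> whose coordinate vector in the chart \<open>c\<close> around \<open>p\<close> is \<open>u\<close>.\<close>

definition coord_vector ::
  "('m::topological_space, 'e::euclidean_space) chart set \<Rightarrow> ('m, 'e) chart \<Rightarrow> 'm \<Rightarrow> 'e \<Rightarrow>
   ('m, 'e) tvec"
  where "coord_vector A c p u =
    (\<lambda>d. if d \<in> A \<and> p \<in> chart_dom d
         then frechet_derivative (chart_map d \<circ> chart_inv c) (at (chart_map c p)) u else 0)"

text \<open>
  The differential of a smooth map \<open>f : M \<rightarrow> M\<close> at \<open>p\<close>; by the chain rule it does not depend on the
  chart chosen around \<open>p\<close>.
\<close>

definition differential ::
  "('m::topological_space, 'e::euclidean_space) chart set \<Rightarrow> ('m \<Rightarrow> 'm) \<Rightarrow> 'm \<Rightarrow>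
   ('m, 'e) tvec \<Rightarrow> ('m, 'e) tvec"
  where "differential A f p v =
    (let c = (SOME c. c \<in> A \<and> p \<in> chart_dom c) in
     (\<lambda>d. if d \<in> A \<and> f p \<in> chart_dom d
          then frechet_derivative (chart_map d \<circ> f \<circ> chart_inv c) (at (chart_map c p)) (v c)
          else 0))"

definition field_coord :: "('m \<Rightarrow> ('m, 'e) tvec) \<Rightarrow> ('m, 'e) chart \<Rightarrow> 'e \<Rightarrow> 'e"
  where "field_coord X c x = X (chart_inv c x) c"

definition vector_fields ::
  "('m::topological_space, 'e::euclidean_space) chart set \<Rightarrow> ('m \<Rightarrow> ('m, 'e) tvec) set"
  where "vector_fields A =
    {X. (\<forall>p. X p \<in> tangent_space A p) \<and> (\<forall>c\<in>A. smooth_on (chart_image c) (field_coord X c))}"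

definition lie_bracket ::
  "('m::topological_space, 'e::euclidean_space) chart set \<Rightarrow>
   ('m \<Rightarrow> ('m, 'e) tvec) \<Rightarrow> ('m \<Rightarrow> ('m, 'e) tvec) \<Rightarrow> 'm \<Rightarrow> ('m, 'e) tvec"
  where "lie_bracket A X Y p =
    (\<lambda>c. if c \<in> A \<and> p \<in> chart_dom c
         then frechet_derivative (field_coord Y c) (at (chart_map c p)) (X p c)
            - frechet_derivative (field_coord X c) (at (chart_map c p)) (Y p c)
         else 0)"


section \<open>Riemannian metrics, geodesics and Killing fields\<close>

type_synonym ('m, 'e) metric = "'m \<Rightarrow> ('m, 'e) tvec \<Rightarrow> ('m, 'e) tvec \<Rightarrow> real"

definition inner_product_on :: "'v::real_vector set \<Rightarrow> ('v \<Rightarrow> 'v \<Rightarrow> real) \<Rightarrow> bool"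
  where "inner_product_on V b \<longleftrightarrow>
    (\<forall>u\<in>V. \<forall>v\<in>V. b u v = b v u) \<and>
    (\<forall>u\<in>V. \<forall>v\<in>V. \<forall>w\<in>V. b (u + v) w = b u w + b v w) \<and>
    (\<forall>r. \<forall>u\<in>V. \<forall>v\<in>V. b (r *\<^sub>R u) v = r * b u v) \<and>
    (\<forall>u\<in>V. u \<noteq> 0 \<longrightarrow> b u u > 0)"

text \<open>The coefficients of the metric at the point with coordinates \<open>x\<close> in the chart \<open>c\<close>.\<close>

definition metric_coord ::
  "('m::topological_space, 'e::euclidean_space) chart set \<Rightarrow> ('m, 'e) metric \<Rightarrow>
   ('m, 'e) chart \<Rightarrow> 'e \<Rightarrow> 'e \<Rightarrow> 'e \<Rightarrow> real"
  where "metric_coord A g c x u w =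
    g (chart_inv c x) (coord_vector A c (chart_inv c x) u) (coord_vector A c (chart_inv c x) w)"

definition riemannian_metric ::
  "('m::topological_space, 'e::euclidean_space) chart set \<Rightarrow> ('m, 'e) metric \<Rightarrow> bool"
  where "riemannian_metric A g \<longleftrightarrow>
    (\<forall>p. inner_product_on (tangent_space A p) (g p)) \<and>
    (\<forall>c\<in>A. \<forall>u w. smooth_on (chart_image c) (\<lambda>x. metric_coord A g c x u w))"

text \<open>
  The Christoffel symbols \<open>\<Gamma>(u, v)\<close> of the Levi-Civita connection in the chart \<open>c\<close>, determined by
  \<open>g(\<Gamma>(u, v), w) = (\<partial>\<^sub>u g(v, w) + \<partial>\<^sub>v g(u, w) - \<partial>\<^sub>w g(u, v)) / 2\<close> for all constant \<open>u, v, w\<close>.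
\<close>

definition christoffel ::
  "('m::topological_space, 'e::euclidean_space) chart set \<Rightarrow> ('m, 'e) metric \<Rightarrow>
   ('m, 'e) chart \<Rightarrow> 'e \<Rightarrow> 'e \<Rightarrow> 'e \<Rightarrow> 'e"
  where "christoffel A g c x u v =
    (THE z. \<forall>w. metric_coord A g c x z w =
       (frechet_derivative (\<lambda>y. metric_coord A g c y v w) (at x) u
      + frechet_derivative (\<lambda>y. metric_coord A g c y u w) (at x) v
      - frechet_derivative (\<lambda>y. metric_coord A g c y u v) (at x) w) / 2)"

text \<open>
  Geodesics on an open interval \<open>J\<close>: around each time, the coordinates \<open>x\<close> of the curve satisfy
  \<open>x'' = - \<Gamma>(x', x')\<close>. This condition does not depend on the chart. Solutions are automatically
  smooth. Values of the curve outside \<open>J\<close> are irrelevant.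
\<close>

definition geodesic ::
  "('m::topological_space, 'e::euclidean_space) chart set \<Rightarrow> ('m, 'e) metric \<Rightarrow>
   real set \<Rightarrow> (real \<Rightarrow> 'm) \<Rightarrow> bool"
  where "geodesic A g J \<gamma> \<longleftrightarrow>
    open J \<and> is_interval J \<and> J \<noteq> {} \<and> continuous_on J \<gamma> \<and>
    (\<forall>t\<in>J. \<exists>c\<in>A. \<gamma> t \<in> chart_dom c \<and>
       (\<exists>v. (\<forall>\<^sub>F s in nhds t. ((chart_map c \<circ> \<gamma>) has_vector_derivative v s) (at s)) \<and>
            (v has_vector_derivative - christoffel A g c (chart_map c (\<gamma> t)) (v t) (v t)) (at t)))"

definition maximal_geodesic ::
  "('m::topological_space, 'e::euclidean_space) chart set \<Rightarrow> ('m, 'e) metric \<Rightarrow>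
   real set \<Rightarrow> (real \<Rightarrow> 'm) \<Rightarrow> bool"
  where "maximal_geodesic A g J \<gamma> \<longleftrightarrow>
    geodesic A g J \<gamma> \<and>
    \<not> (\<exists>J' \<gamma>'. J \<subset> J' \<and> geodesic A g J' \<gamma>' \<and> (\<forall>t\<in>J. \<gamma>' t = \<gamma> t))"

text \<open>The isometry group consists of the diffeomorphisms of \<open>M\<close> that preserve the metric.\<close>

definition isometry_group ::
  "('m::topological_space, 'e::euclidean_space) chart set \<Rightarrow> ('m, 'e) metric \<Rightarrow> ('m \<Rightarrow> 'm) set"
  where "isometry_group A g =
    {f. bij f \<and> smooth_map A A f \<and> smooth_map A A (inv f) \<and>
        (\<forall>p. \<forall>v\<in>tangent_space A p. \<forall>w\<in>tangent_space A p.
           g (f p) (differential A f p v) (differential A f p w) = g p v w)}"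

text \<open>
  One-parameter subgroups of the Lie group of isometries: homomorphisms from \<open>\<real>\<close> to the isometry
  group that are smooth, which for this Lie group means that the induced action \<open>\<real> \<times> M \<rightarrow> M\<close> is
  smooth.
\<close>

definition one_parameter_subgroup ::
  "('m::topological_space, 'e::euclidean_space) chart set \<Rightarrow> ('m, 'e) metric \<Rightarrow>
   (real \<Rightarrow> 'm \<Rightarrow> 'm) \<Rightarrow> bool"
  where "one_parameter_subgroup A g \<phi> \<longleftrightarrow>
    (\<forall>t. \<phi> t \<in> isometry_group A g) \<and>
    (\<forall>s t. \<phi> (s + t) = \<phi> s \<circ> \<phi> t) \<and>
    smooth_map (time_atlas A) A (\<lambda>(t, p). \<phi> t p)"

text \<open>
  Geodesics are taken to be maximal here, since a proper piece of a geodesic need not be an orbit.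
\<close>

definition geodesic_orbit ::
  "('m::topological_space, 'e::euclidean_space) chart set \<Rightarrow> ('m, 'e) metric \<Rightarrow> bool"
  where "geodesic_orbit A g \<longleftrightarrow>
    (\<forall>J \<gamma>. maximal_geodesic A g J \<gamma> \<longrightarrow>
       (\<exists>\<phi> p. one_parameter_subgroup A g \<phi> \<and> \<gamma> ` J = range (\<lambda>t. \<phi> t p)))"

text \<open>
  Killing fields are the vector fields \<open>X\<close> with \<open>L\<^sub>X g = 0\<close>; in a chart,
  \<open>(L\<^sub>X g)(u, w) = \<partial>\<^sub>X g(u, w) + g(\<partial>\<^sub>u X, w) + g(u, \<partial>\<^sub>w X)\<close> for constant \<open>u, w\<close>.
\<close>

definition killing_fields ::
  "('m::topological_space, 'e::euclidean_space) chart set \<Rightarrow> ('m, 'e) metric \<Rightarrow>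
   ('m \<Rightarrow> ('m, 'e) tvec) set"
  where "killing_fields A g =
    {X \<in> vector_fields A. \<forall>c\<in>A. \<forall>x\<in>chart_image c. \<forall>u w.
       frechet_derivative (\<lambda>y. metric_coord A g c y u w) (at x) (field_coord X c x)
     + metric_coord A g c x (frechet_derivative (field_coord X c) (at x) u) w
     + metric_coord A g c x u (frechet_derivative (field_coord X c) (at x) w) = 0}"

definition lie_ideal :: "('v \<Rightarrow> 'v \<Rightarrow> 'v) \<Rightarrow> 'v::real_vector set \<Rightarrow> 'v set \<Rightarrow> bool"
  where "lie_ideal br L I \<longleftrightarrow>
    subspace I \<and> I \<subseteq> L \<and> (\<forall>X\<in>L. \<forall>Y\<in>I. br X Y \<in> I)"

definition lie_abelian :: "('v \<Rightarrow> 'v \<Rightarrow> 'v) \<Rightarrow> 'v::real_vector set \<Rightarrow> bool"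
  where "lie_abelian br I \<longleftrightarrow> (\<forall>X\<in>I. \<forall>Y\<in>I. br X Y = 0)"

end

theory Submission
  imports Defs
begin

text \<open>
  Fix a point \<open>p\<close> with \<open>X(p) \<noteq> 0\<close>. The geodesic starting with velocity \<open>X(p)\<close> is an orbit of a
  one-parameter group of isometries, so after rescaling its generator there is a Killing field \<open>Z\<close>
  with \<open>Z(p) = X(p)\<close> and \<open>\<nabla>\<^sub>Z Z = \<lambda> Z\<close> at \<open>p\<close>; pairing with \<open>Z\<close> shows \<open>\<lambda> = 0\<close>. Let
  \<open>Y = [Z, X]\<close>, which lies in the abelian ideal. At \<open>p\<close>, the Killing equations together with
  \<open>[X, Y] = 0\<close> and \<open>\<nabla>\<^sub>Z Z = 0\<close> give \<open>g(Y, Y) = 0\<close>, hence \<open>\<nabla>\<^sub>X X = \<nabla>\<^sub>Z X = \<nabla>\<^sub>Z Z + Y = 0\<close> at \<open>p\<close>. So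
  \<open>\<partial>\<^sub>u g(X, X) = - 2 g(u, \<nabla>\<^sub>X X) = 0\<close> at \<open>p\<close> for all \<open>u\<close>.
\<close>


section \<open>Calculus of smooth functions\<close>

text \<open>The geodesic orbit property compares sets of points only, so the parametrisation has to
  be recovered: the velocity of the geodesic is shown to be a multiple \<open>k s\<close> of the
  generator \<open>Z\<close>, and \<lambda> comes from differentiating this relation and comparing
  with the geodesic equation. As the property speaks of maximal geodesics, a geodesic with
  prescribed velocity must first be produced and extended; its existence rests on a Lipschitz
  estimate for Christoffel symbols that are known only through a linear system. The reason for g(Y,
  Y) = 0 is that \<open>Y = \<nabla>\<^sub>X X\<close> at \<open>p\<close>, since Z = X there and
  \<open>\<nabla>\<^sub>Z Z = 0\<close>. Skewness of \<nabla>X gives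
  \<open>g(\<nabla>\<^sub>X X, Y) = - g(X, \<nabla>\<^sub>Y X)\<close>; as X and Y commute, this is
  \<open>- g(X, \<nabla>\<^sub>X Y)\<close>, which vanishes by skewness of \<nabla>Y. All of this is
  carried out with partial derivatives in one chart. At zeros of X the length is critical because it
  is quadratic in X.\<close>

lemma Ck_on_cong:
  assumes "open S" "\<And>x. x \<in> S \<Longrightarrow> f x = h x" "Ck_on k S f"
  shows "Ck_on k S h"
  using assms(2,3)
proof (induction k arbitrary: f h)
  case 0
  then show ?case by (auto cong: continuous_on_cong)
next
  case (Suc k)
  have eq: "frechet_derivative f (at x) = frechet_derivative h (at x)" if "x \<in> S" for x
    using Suc.prems that assms(1) frechet_derivative_transform_within_open[of f x S h] by auto
  have "h differentiable (at x)" if "x \<in> S" for x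
  proof -
    obtain D where "(f has_derivative D) (at x)"
      using Suc.prems \<open>x \<in> S\<close> by (auto simp: differentiable_def)
    then have "(h has_derivative D) (at x)"
      by (rule has_derivative_transform_within_open[OF _ assms(1) that Suc.prems(1)])
    then show ?thesis by (auto simp: differentiable_def)
  qed
  moreover have "Ck_on k S (\<lambda>x. frechet_derivative h (at x) v)" for v
    by (rule Suc.IH[of "\<lambda>x. frechet_derivative f (at x) v"]) (use Suc.prems eq in auto)
  ultimately show ?case by auto
qed

lemma smooth_on_cong:
  "open S \<Longrightarrow> (\<And>x. x \<in> S \<Longrightarrow> f x = h x) \<Longrightarrow> smooth_on S f \<Longrightarrow> smooth_on S h"
  unfolding smooth_on_def using Ck_on_cong by blast

lemma smooth_on_continuous: "smooth_on S f \<Longrightarrow> continuous_on S f"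
  unfolding smooth_on_def by (metis Ck_on.simps(1))

lemma smooth_on_differentiable: "smooth_on S f \<Longrightarrow> x \<in> S \<Longrightarrow> f differentiable (at x)"
  unfolding smooth_on_def by (metis Ck_on.simps(2))

lemma smooth_on_has_derivative:
  "smooth_on S f \<Longrightarrow> x \<in> S \<Longrightarrow> (f has_derivative frechet_derivative f (at x)) (at x)"
  using smooth_on_differentiable frechet_derivative_works by blast

lemma smooth_on_derivative:
  "smooth_on S f \<Longrightarrow> smooth_on S (\<lambda>x. frechet_derivative f (at x) v)"
  unfolding smooth_on_def by (metis Ck_on.simps(2))

section \<open>Freezing one argument of a function on a product\<close>

lemma has_derivative_slice:
  assumes "(f has_derivative f') (at (t, x))"
  shows "((\<lambda>x. f (t, x)) has_derivative (\<lambda>v. f' (0, v))) (at x)"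
  by (rule has_derivative_compose[where f = "Pair t" and g = f and g' = f', OF _ assms])
    (rule has_derivative_Pair[OF has_derivative_const has_derivative_ident])

lemma has_vector_derivative_slice:
  assumes "(f has_derivative f') (at (t, x))"
  shows "((\<lambda>t. f (t, x)) has_vector_derivative f' (1, 0)) (at t)"
proof -
  have "((\<lambda>t. f (t, x)) has_derivative (\<lambda>v. f' (v, 0))) (at t)"
    by (rule has_derivative_compose[where f = "\<lambda>t. (t, x)" and g = f and g' = f', OF _ assms])
      (rule has_derivative_Pair[OF has_derivative_ident has_derivative_const])
  moreover have "(\<lambda>v. f' (v, 0)) = (\<lambda>v. v *\<^sub>R f' (1, 0))"
  proof (rule ext)
    fix v show "f' (v, 0) = v *\<^sub>R f' (1, 0)"
      using linear_scale[OF has_derivative_linear[OF assms], of v "(1, 0)"] by simp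
  qed
  ultimately show ?thesis
    unfolding has_vector_derivative_def by (simp only:)
qed

text \<open>Differentiating the slice in direction \<open>v\<close> amounts to slicing the
  derivative of \<open>f\<close> in direction \<open>(0, v)\<close>. The induction moves on to that
  function, which is why \<open>f\<close> is left arbitrary.\<close>

lemma smooth_on_slice:
  assumes "smooth_on W f" "open S" "\<And>x. x \<in> S \<Longrightarrow> (t, x) \<in> W"
  shows "smooth_on S (\<lambda>x. f (t, x))"
proof -
  have "Ck_on k S (\<lambda>x. f (t, x))" if "Ck_on k W f" for k
    using that
  proof (induction k arbitrary: f)
    case 0
    have "continuous_on S (\<lambda>x. (t, x))" by (intro continuous_intros)
    then show ?case
      using 0 assms(3) continuous_on_compose2[of W f S "\<lambda>x. (t, x)"] by auto
  next
    case (Suc k)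
    have der: "((\<lambda>x. f (t, x)) has_derivative (\<lambda>v. frechet_derivative f (at (t, x)) (0, v))) (at x)"
      if "x \<in> S" for x
    proof (rule has_derivative_slice)
      show "(f has_derivative frechet_derivative f (at (t, x))) (at (t, x))"
        using Suc.prems assms(3)[OF that] frechet_derivative_works by auto
    qed
    have Ck: "Ck_on k S (\<lambda>x. frechet_derivative f (at (t, x)) (0, v))" for v
      using Suc.IH[of "\<lambda>p. frechet_derivative f (at p) (0, v)"] Suc.prems by auto
    have "frechet_derivative f (at (t, x)) (0, v) = frechet_derivative (\<lambda>x. f (t, x)) (at x) v"
      if "x \<in> S" for x v
      using fun_cong[OF frechet_derivative_at[OF der[OF that]]] .
    then have "Ck_on k S (\<lambda>x. frechet_derivative (\<lambda>x. f (t, x)) (at x) v)" for v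
      by (rule Ck_on_cong[OF assms(2) _ Ck])
    then show ?case
      using der by (auto simp: differentiable_def)
  qed
  then show ?thesis
    using assms(1) by (auto simp: smooth_on_def)
qed


section \<open>Symmetry of second derivatives\<close>

lemma double_difference_mean_value:
  fixes f :: "'a::real_normed_vector \<Rightarrow> real"
  assumes h: "h > 0"
    and W: "\<And>s t. 0 \<le> s \<Longrightarrow> s \<le> h \<Longrightarrow> 0 \<le> t \<Longrightarrow> t \<le> h \<Longrightarrow> q + s *\<^sub>R u + t *\<^sub>R v \<in> W"
    and f: "\<And>p. p \<in> W \<Longrightarrow> (f has_derivative f' p) (at p)"
    and f': "\<And>p. p \<in> W \<Longrightarrow> ((\<lambda>p. f' p u) has_derivative f'' p) (at p)"
  obtains s t where "0 < s" "s < h" "0 < t" "t < h"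
    "f (q + h *\<^sub>R u + h *\<^sub>R v) - f (q + h *\<^sub>R u) - f (q + h *\<^sub>R v) + f q
      = h * h * f'' (q + s *\<^sub>R u + t *\<^sub>R v) v"
proof -
  have lin: "linear (f' p)" "linear (f'' p)" if "p \<in> W" for p
    using f[OF that] f'[OF that] has_derivative_linear by auto
  \<comment> \<open>The double difference is the increment of \<open>F\<close> over [0, h]. The mean
    value theorem for \<open>F\<close> yields \<open>s\<close>; a second application, to the
    derivative in direction \<open>u\<close> moved along \<open>v\<close>, yields
    \<open>t\<close>.\<close>
  define F where "F s = f (q + s *\<^sub>R u + h *\<^sub>R v) - f (q + s *\<^sub>R u)" for s
  have F: "(F has_real_derivative (f' (q + s *\<^sub>R u + h *\<^sub>R v) u - f' (q + s *\<^sub>R u) u)) (at s)"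
    if s: "0 \<le> s" "s \<le> h" for s
  proof -
    have 1: "((\<lambda>s. f (q + s *\<^sub>R u + t *\<^sub>R v)) has_real_derivative f' (q + s *\<^sub>R u + t *\<^sub>R v) u) (at s)"
      if t: "0 \<le> t" "t \<le> h" for t
    proof -
      have w: "q + s *\<^sub>R u + t *\<^sub>R v \<in> W" using W s t by auto
      have "((\<lambda>s. f (q + s *\<^sub>R u + t *\<^sub>R v)) has_derivative (\<lambda>r. f' (q + s *\<^sub>R u + t *\<^sub>R v) (r *\<^sub>R u))) (at s)"
        by (rule has_derivative_compose[where f = "\<lambda>s. q + s *\<^sub>R u + t *\<^sub>R v" and g = f, OF _ f[OF w]]) (auto intro!: derivative_eq_intros)
      then show ?thesis
        using lin(1)[OF w] by (simp add: linear_scale has_field_derivative_def mult_commute_abs)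
    qed
    from DERIV_diff[OF 1[of h] 1[of 0]] h show ?thesis by (simp add: F_def[abs_def])
  qed
  obtain s where s: "0 < s" "s < h"
    "F h - F 0 = (h - 0) * (f' (q + s *\<^sub>R u + h *\<^sub>R v) u - f' (q + s *\<^sub>R u) u)"
    using MVT2[OF h F] by (auto simp: F_def)
  have G: "((\<lambda>t. f' (q + s *\<^sub>R u + t *\<^sub>R v) u) has_real_derivative f'' (q + s *\<^sub>R u + t *\<^sub>R v) v) (at t)"
    if t: "0 \<le> t" "t \<le> h" for t
  proof -
    have w: "q + s *\<^sub>R u + t *\<^sub>R v \<in> W" using W s t by auto
    have "((\<lambda>t. f' (q + s *\<^sub>R u + t *\<^sub>R v) u) has_derivative (\<lambda>r. f'' (q + s *\<^sub>R u + t *\<^sub>R v) (r *\<^sub>R v))) (at t)"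
      by (rule has_derivative_compose[where f = "\<lambda>t. q + s *\<^sub>R u + t *\<^sub>R v" and g = "\<lambda>p. f' p u", OF _ f'[OF w]]) (auto intro!: derivative_eq_intros)
    then show ?thesis
      using lin(2)[OF w] by (simp add: linear_scale has_field_derivative_def mult_commute_abs)
  qed
  obtain t where t: "0 < t" "t < h"
    "f' (q + s *\<^sub>R u + h *\<^sub>R v) u - f' (q + s *\<^sub>R u + 0 *\<^sub>R v) u = (h - 0) * f'' (q + s *\<^sub>R u + t *\<^sub>R v) v"
    using MVT2[OF h G] by auto
  show ?thesis
  proof (rule that[OF s(1,2) t(1,2)])
    have "f (q + h *\<^sub>R u + h *\<^sub>R v) - f (q + h *\<^sub>R u) - f (q + h *\<^sub>R v) + f q = F h - F 0"
      by (simp add: F_def)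
    also have "\<dots> = h * (h * f'' (q + s *\<^sub>R u + t *\<^sub>R v) v)"
      using s(3) t(3) by simp
    finally show "f (q + h *\<^sub>R u + h *\<^sub>R v) - f (q + h *\<^sub>R u) - f (q + h *\<^sub>R v) + f q
      = h * h * f'' (q + s *\<^sub>R u + t *\<^sub>R v) v"
      by (simp only: mult.assoc)
  qed
qed

text \<open>Both mixed derivatives are limits of the same second difference.\<close>

lemma mixed_derivatives_eq_real:
  fixes f :: "'a::real_normed_vector \<Rightarrow> real"
  assumes "open W" "q \<in> W"
    and f: "\<And>p. p \<in> W \<Longrightarrow> (f has_derivative f' p) (at p)"
    and f1: "\<And>p. p \<in> W \<Longrightarrow> ((\<lambda>p. f' p u) has_derivative f1 p) (at p)"
    and f2: "\<And>p. p \<in> W \<Longrightarrow> ((\<lambda>p. f' p v) has_derivative f2 p) (at p)"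
    and c1: "continuous_on W (\<lambda>p. f1 p v)" and c2: "continuous_on W (\<lambda>p. f2 p u)"
  shows "f1 q v = f2 q u"
proof (rule ccontr)
  assume "f1 q v \<noteq> f2 q u"
  \<comment> \<open>Half the gap: no number lies closer than \<open>e\<close> to both mixed
    derivatives.\<close>
  define e where "e = \<bar>f1 q v - f2 q u\<bar> / 2"
  have "e > 0" using \<open>f1 q v \<noteq> f2 q u\<close> by (simp add: e_def)
  have near_q: "\<forall>\<^sub>F p in nhds q. dist (k p) (k q) < e" if "continuous_on W k" for k :: "'a \<Rightarrow> real"
  proof (rule tendstoD[OF _ \<open>e > 0\<close>])
    show "(k \<longlongrightarrow> k q) (nhds q)"
      using that assms(1,2) by (simp add: continuous_on_eq_continuous_at isCont_def flip: tendsto_at_iff_tendsto_nhds)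
  qed
  note near_q[OF c1] near_q[OF c2]
  moreover have "\<forall>\<^sub>F p in nhds q. p \<in> W"
    using assms(1,2) eventually_nhds_in_open by blast
  ultimately have "\<forall>\<^sub>F p in nhds q. p \<in> W \<and> dist (f1 p v) (f1 q v) < e \<and> dist (f2 p u) (f2 q u) < e"
    by eventually_elim auto
  then obtain d where d: "d > 0"
    "\<And>p. dist p q < d \<Longrightarrow> p \<in> W \<and> dist (f1 p v) (f1 q v) < e \<and> dist (f2 p u) (f2 q u) < e"
    unfolding eventually_nhds_metric by blast
  \<comment> \<open>The summand 1 keeps \<open>N\<close> positive when \<open>u\<close> and
    \<open>v\<close> vanish; \<open>h = d / (2 * N)\<close> then puts the whole parallelogram within
    d / 2 of \<open>q\<close>.\<close>
  define N where "N = norm u + norm v + 1"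
  have N: "N > 0" by (simp add: N_def add_nonneg_pos)
  define h where "h = d / (2 * N)"
  have h: "h > 0" using d(1) N by (simp add: h_def)
  have near: "dist (q + s *\<^sub>R u + t *\<^sub>R v) q < d" if "0 \<le> s" "s \<le> h" "0 \<le> t" "t \<le> h" for s t
  proof -
    have "dist (q + s *\<^sub>R u + t *\<^sub>R v) q = norm (s *\<^sub>R u + t *\<^sub>R v)" by (simp add: dist_norm)
    also have "\<dots> \<le> norm (s *\<^sub>R u) + norm (t *\<^sub>R v)" by (rule norm_triangle_ineq)
    also have "\<dots> \<le> h * norm u + h * norm v" using that by (auto intro!: add_mono mult_right_mono)
    also have "\<dots> \<le> h * N" using h by (simp add: N_def algebra_simps)
    also have "\<dots> = d / 2" using N by (simp add: h_def)
    finally show ?thesis using d(1) by simp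
  qed
  have nearW: "q + s *\<^sub>R u + t *\<^sub>R v \<in> W" if "0 \<le> s" "s \<le> h" "0 \<le> t" "t \<le> h" for s t
    using d(2)[OF near[OF that]] by blast
  obtain s t where 1: "0 < s" "s < h" "0 < t" "t < h"
    "f (q + h *\<^sub>R u + h *\<^sub>R v) - f (q + h *\<^sub>R u) - f (q + h *\<^sub>R v) + f q
      = h * h * f1 (q + s *\<^sub>R u + t *\<^sub>R v) v"
    using double_difference_mean_value[OF h, of q u v W f f' f1] nearW f f1 by blast
  have nearW': "q + s *\<^sub>R v + t *\<^sub>R u \<in> W" if "0 \<le> s" "s \<le> h" "0 \<le> t" "t \<le> h" for s t
    using nearW[of t s] that by (simp add: add.commute add.left_commute)
  obtain s' t' where 2: "0 < s'" "s' < h" "0 < t'" "t' < h"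
    "f (q + h *\<^sub>R v + h *\<^sub>R u) - f (q + h *\<^sub>R v) - f (q + h *\<^sub>R u) + f q
      = h * h * f2 (q + s' *\<^sub>R v + t' *\<^sub>R u) u"
    using double_difference_mean_value[OF h, of q v u W f f' f2] nearW' f f2 by blast
  have sw: "q + h *\<^sub>R v + h *\<^sub>R u = q + h *\<^sub>R u + h *\<^sub>R v"
    "q + s' *\<^sub>R v + t' *\<^sub>R u = q + t' *\<^sub>R u + s' *\<^sub>R v" by (simp_all add: algebra_simps)
  have "h * h * f1 (q + s *\<^sub>R u + t *\<^sub>R v) v = h * h * f2 (q + t' *\<^sub>R u + s' *\<^sub>R v) u"
    using 1(5) 2(5) unfolding sw by linarith
  then have "f1 (q + s *\<^sub>R u + t *\<^sub>R v) v = f2 (q + t' *\<^sub>R u + s' *\<^sub>R v) u" using h by simp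
  moreover have "dist (f1 (q + s *\<^sub>R u + t *\<^sub>R v) v) (f1 q v) < e"
    using d(2)[OF near] 1 by (meson less_imp_le)
  moreover have "dist (f2 (q + t' *\<^sub>R u + s' *\<^sub>R v) u) (f2 q u) < e"
    using d(2)[OF near] 2 by (meson less_imp_le)
  moreover have "\<bar>a - b\<bar> \<le> \<bar>x - a\<bar> + \<bar>x - b\<bar>" for a b x :: real by linarith
  ultimately show False
    unfolding e_def dist_real_def by (smt (verit) field_sum_of_halves)
qed

text \<open>The mean value argument needs real values, hence the passage to components. Applied to a
  flow, this interchanges time and space derivatives.\<close>

lemma smooth_on_mixed_derivatives_eq:
  fixes f :: "'a::real_normed_vector \<Rightarrow> 'b::euclidean_space"
  assumes "smooth_on W f" "open W" "q \<in> W"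
  shows "frechet_derivative (\<lambda>p. frechet_derivative f (at p) u) (at q) v
    = frechet_derivative (\<lambda>p. frechet_derivative f (at p) v) (at q) u"
proof (rule euclidean_eqI)
  fix i :: 'b assume "i \<in> Basis"
  note s = smooth_on_derivative[OF assms(1)]
  show "frechet_derivative (\<lambda>p. frechet_derivative f (at p) u) (at q) v \<bullet> i
    = frechet_derivative (\<lambda>p. frechet_derivative f (at p) v) (at q) u \<bullet> i"
  proof -
    have 1: "((\<lambda>p. f p \<bullet> i) has_derivative (\<lambda>w. frechet_derivative f (at p) w \<bullet> i)) (at p)" if "p \<in> W" for p
      by (rule has_derivative_inner_left[OF smooth_on_has_derivative[OF assms(1) that]])
    have 2: "((\<lambda>p. frechet_derivative f (at p) w \<bullet> i) has_derivative
        (\<lambda>w'. frechet_derivative (\<lambda>p. frechet_derivative f (at p) w) (at p) w' \<bullet> i)) (at p)"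
      if "p \<in> W" for p w
      by (rule has_derivative_inner_left[OF smooth_on_has_derivative[OF s that]])
    have 3: "continuous_on W (\<lambda>p. frechet_derivative (\<lambda>p. frechet_derivative f (at p) w) (at p) w' \<bullet> i)" for w w'
      by (intro continuous_on_inner smooth_on_continuous[OF smooth_on_derivative[OF s]] continuous_on_const)
    show ?thesis
      by (rule mixed_derivatives_eq_real[OF assms(2,3) 1 2 2 3 3])
  qed
qed

section \<open>Ordinary differential equations\<close>

text \<open>Banach's fixed point theorem for the integral equation. Clamping time to [-e, e] makes
  the integral operator a self-map of the complete space of bounded continuous functions on the
  whole line.\<close>

lemma picard_global:
  fixes F :: "'a::euclidean_space \<Rightarrow> 'a"
  assumes F: "\<And>x y. norm (F x - F y) \<le> L * norm (x - y)"
  obtains e u where "e > 0" "u 0 = a" "\<And>t. \<bar>t\<bar> < e \<Longrightarrow> (u has_vector_derivative F (u t)) (at t)"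
proof -
  have L: "L \<ge> 0"
    using F[of "SOME i. i \<in> Basis" 0] norm_ge_zero[of "F (SOME i. i \<in> Basis) - F 0"]
    by (metis diff_zero mult.right_neutral norm_some_Basis order_trans)
  have "L-lipschitz_on UNIV F" using F L by (auto simp: lipschitz_on_def dist_norm)
  then have cF: "continuous_on UNIV F" by (rule lipschitz_on_continuous_on)
  \<comment> \<open>The integrals in \<open>I\<close> run over length at most \<open>2 * e\<close>,
    so \<open>I\<close> is Lipschitz in \<open>u\<close> with constant
    \<open>2 * e * L \<le> 1/4\<close>; \<open>T\<close> contains two such terms, hence the
    contraction factor 1/2.\<close>
  define e where "e = 1 / (8 * (L + 1))"
  have e: "e > 0" using L by (simp add: e_def)
  define c where "c t = max (- e) (min e t)" for t :: real
  have c: "c t \<in> {-e..e}" for t using e by (auto simp: c_def)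
  have cc: "continuous_on UNIV c" unfolding c_def by (intro continuous_intros)
  \<comment> \<open>Starting at \<open>-e\<close> keeps the interval oriented for negative times as
    well; \<open>I u t - I u 0\<close> is the signed integral from 0 to \<open>t\<close>.\<close>
  define I where "I u t = integral {-e..t} (\<lambda>s. F (u s))" for u :: "real \<Rightarrow> 'a" and t
  define T where "T u t = a + (I u (c t) - I u 0)" for u :: "real \<Rightarrow> 'a" and t
  have cu: "continuous_on S (\<lambda>s. F (apply_bcontfun u s))" for u S
    by (rule continuous_on_compose2[OF cF]) auto
  have int: "(\<lambda>s. F (apply_bcontfun u s)) integrable_on {p..q}"
    for u :: "real \<Rightarrow>\<^sub>C 'a" and p q
    by (rule integrable_continuous_real) (rule cu)
  have contI: "continuous_on {-e..e} (I u)" for u :: "real \<Rightarrow>\<^sub>C 'a"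
    unfolding I_def by (rule indefinite_integral_continuous_1[OF int])
  have TB: "T u \<in> bcontfun" for u :: "real \<Rightarrow>\<^sub>C 'a"
  proof -
    have "continuous_on UNIV (T u)"
      unfolding T_def using c by (intro continuous_intros continuous_on_compose2[OF contI cc]) auto
    moreover have "bounded (T u ` UNIV)"
    proof (rule bounded_subset)
      show "bounded ((\<lambda>t. a + (I u t - I u 0)) ` {-e..e})"
        by (intro compact_imp_bounded compact_continuous_image continuous_intros contI compact_Icc)
    qed (use c in \<open>auto simp: T_def\<close>)
    ultimately show ?thesis by (simp add: bcontfun_def)
  qed
  define P where "P u = Bcontfun (T u)" for u :: "real \<Rightarrow>\<^sub>C 'a"
  have P: "apply_bcontfun (P u) = T u" for u
    unfolding P_def by (rule Bcontfun_inverse[OF TB])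
  have dI: "norm (I u t - I w t) \<le> dist u w / 4" if "t \<in> {-e..e}" for t and u w :: "real \<Rightarrow>\<^sub>C 'a"
  proof -
    have "I u t - I w t = integral {-e..t} (\<lambda>s. F (u s) - F (w s))"
      unfolding I_def by (rule integral_diff[symmetric, OF int int])
    also have "norm \<dots> \<le> L * dist u w * (t - (-e))"
    proof (rule integral_bound)
      show "norm (F (u s) - F (w s)) \<le> L * dist u w" for s
        using F[of "u s" "w s"] dist_bounded[of u s w] L
        by (smt (verit) dist_norm mult_left_mono)
    qed (use that in \<open>auto intro!: continuous_intros cu\<close>)
    also have "\<dots> \<le> L * dist u w * (2 * e)"
      using that L by (intro mult_left_mono) auto
    also have "\<dots> = (L / (L + 1)) * (dist u w / 4)" using L by (simp add: e_def divide_simps)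
    also have "\<dots> \<le> 1 * (dist u w / 4)" using L by (intro mult_right_mono) auto
    finally show ?thesis by simp
  qed
  have "dist (P u) (P w) \<le> 1/2 * dist u w" for u w
  proof (rule dist_bound)
    fix t
    have "dist (P u t) (P w t) = norm ((I u (c t) - I w (c t)) - (I u 0 - I w 0))"
      by (simp add: P T_def dist_norm algebra_simps)
    also have "\<dots> \<le> dist u w / 4 + dist u w / 4"
      using dI[OF c, of u t w] dI[of 0 u w] e by (intro norm_triangle_le_diff) auto
    finally show "dist (P u t) (P w t) \<le> 1/2 * dist u w" by simp
  qed
  then have "\<exists>!u. P u = u"
    by (intro banach_fix_type[of "1/2"]) auto
  then obtain u where "P u = u" by blast
  then have u: "u t = a + (I u (c t) - I u 0)" for t
    by (metis P T_def)
  have "(u has_vector_derivative F (u t)) (at t)" if "\<bar>t\<bar> < e" for t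
  proof -
    have t: "t \<in> {-e<..<e}" using that by auto
    have "((\<lambda>t. integral {-e..t} (\<lambda>s. F (u s))) has_vector_derivative F (u t)) (at t within {-e..e})"
      by (rule integral_has_vector_derivative[OF cu]) (use t in auto)
    then have "(I u has_vector_derivative F (u t)) (at t)"
      using t by (simp add: at_within_Icc_at I_def[abs_def])
    then have "((\<lambda>t. a + (I u t - I u 0)) has_vector_derivative F (u t)) (at t)"
      by (auto intro!: derivative_eq_intros)
    then show ?thesis
      by (rule has_vector_derivative_transform_within_open[OF _ open_greaterThanLessThan t])
        (use u in \<open>auto simp: c_def\<close>)
  qed
  moreover have "u 0 = a" using u[of 0] e by (simp add: c_def)
  ultimately show ?thesis using that e by blast
qed

section \<open>Functions that are Lipschitz near a point, and their closure rules\<close>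

definition locally_lipschitz_at :: "('a::metric_space \<Rightarrow> 'b::metric_space) \<Rightarrow> 'a \<Rightarrow> bool"
  where "locally_lipschitz_at F a \<longleftrightarrow> (\<exists>r>0. \<exists>L. L-lipschitz_on (cball a r) F)"

text \<open>Composition with the nearest-point projection onto a ball, which is 1-Lipschitz by
  convexity, makes the field globally Lipschitz. For short times the solution stays in the ball,
  where the projection is the identity.\<close>

lemma picard_local:
  fixes F :: "'a::euclidean_space \<Rightarrow> 'a"
  assumes "locally_lipschitz_at F a" "open S" "a \<in> S"
  obtains e u where "e > 0" "u 0 = a"
    "\<And>t. \<bar>t\<bar> < e \<Longrightarrow> u t \<in> S \<and> (u has_vector_derivative F (u t)) (at t)"
proof -
  obtain r L where r: "r > 0" "L-lipschitz_on (cball a r) F"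
    using assms(1) by (auto simp: locally_lipschitz_at_def)
  define c where "c = closest_point (cball a r)"
  have c: "c x \<in> cball a r" for x
    unfolding c_def using r by (intro closest_point_in_set) auto
  have "norm (F (c x) - F (c y)) \<le> L * norm (x - y)" for x y
  proof -
    have "dist (F (c x)) (F (c y)) \<le> L * dist (c x) (c y)"
      using lipschitz_onD[OF r(2)] c by blast
    also have "dist (c x) (c y) \<le> dist x y"
      unfolding c_def using r by (intro closest_point_lipschitz) auto
    finally show ?thesis
      using lipschitz_on_nonneg[OF r(2)] by (simp add: dist_norm mult_left_mono)
  qed
  then obtain e u where e: "e > 0" "u 0 = a"
    "\<And>t. \<bar>t\<bar> < e \<Longrightarrow> (u has_vector_derivative F (c (u t))) (at t)"
    using picard_global[of "\<lambda>x. F (c x)" L a] by blast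
  have "isCont u 0"
    using e(3)[of 0] e(1) has_vector_derivative_continuous by auto
  moreover have "open (S \<inter> ball a r)" "u 0 \<in> S \<inter> ball a r" using assms r e by auto
  ultimately have "\<forall>\<^sub>F t in nhds 0. u t \<in> S \<inter> ball a r"
    unfolding isCont_def tendsto_at_iff_tendsto_nhds by (rule topological_tendstoD)
  then obtain d where d: "d > 0" "\<And>t. \<bar>t\<bar> < d \<Longrightarrow> u t \<in> S \<inter> ball a r"
    unfolding eventually_nhds_metric by (auto simp: dist_real_def)
  show ?thesis
  proof (rule that[of "min d e" u])
    fix t assume "\<bar>t\<bar> < min d e"
    then have "u t \<in> S \<inter> ball a r" "(u has_vector_derivative F (c (u t))) (at t)"
      using d e by auto
    moreover from this have "c (u t) = u t"
      unfolding c_def by (intro closest_point_self) auto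
    ultimately show "u t \<in> S \<and> (u has_vector_derivative F (u t)) (at t)" by auto
  qed (use d e in auto)
qed

lemma locally_lipschitz_at_common_ball:
  assumes "locally_lipschitz_at F a" "locally_lipschitz_at H a"
  obtains r L M where "r > 0" "L-lipschitz_on (cball a r) F" "M-lipschitz_on (cball a r) H"
proof -
  obtain r L r' M where "r > 0" "L-lipschitz_on (cball a r) F" "r' > 0" "M-lipschitz_on (cball a r') H"
    using assms by (auto simp: locally_lipschitz_at_def)
  moreover have "cball a (min r r') \<subseteq> cball a r" "cball a (min r r') \<subseteq> cball a r'" by auto
  ultimately show ?thesis
    using that[of "min r r'" L M] lipschitz_on_subset by (metis min_less_iff_conj)
qed

lemma locally_lipschitz_at_const: "locally_lipschitz_at (\<lambda>_. c) a"
  unfolding locally_lipschitz_at_def using lipschitz_on_constant zero_less_one by blast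

lemma locally_lipschitz_at_add:
  fixes F H :: "'a::metric_space \<Rightarrow> 'b::real_normed_vector"
  assumes "locally_lipschitz_at F a" "locally_lipschitz_at H a" shows "locally_lipschitz_at (\<lambda>x. F x + H x) a"
proof -
  obtain r L M where "r > 0" "L-lipschitz_on (cball a r) F" "M-lipschitz_on (cball a r) H"
    using locally_lipschitz_at_common_ball[OF assms] .
  then show ?thesis unfolding locally_lipschitz_at_def using lipschitz_on_add by blast
qed

lemma locally_lipschitz_at_sum:
  fixes F :: "'i \<Rightarrow> 'a::metric_space \<Rightarrow> 'b::real_normed_vector"
  assumes "\<And>i. i \<in> I \<Longrightarrow> locally_lipschitz_at (F i) a" shows "locally_lipschitz_at (\<lambda>x. \<Sum>i\<in>I. F i x) a"
  using assms by (induction I rule: infinite_finite_induct) (auto intro: locally_lipschitz_at_const locally_lipschitz_at_add)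

lemma locally_lipschitz_at_linear:
  assumes "bounded_linear F" shows "locally_lipschitz_at F a"
  using bounded_linear.lipschitz_boundE[OF assms] zero_less_one unfolding locally_lipschitz_at_def by metis

lemma locally_lipschitz_at_Pair:
  assumes "locally_lipschitz_at F a" "locally_lipschitz_at H a" shows "locally_lipschitz_at (\<lambda>x. (F x, H x)) a"
proof -
  obtain r L M where "r > 0" "L-lipschitz_on (cball a r) F" "M-lipschitz_on (cball a r) H"
    using locally_lipschitz_at_common_ball[OF assms] .
  then show ?thesis unfolding locally_lipschitz_at_def using lipschitz_on_Pair by blast
qed

lemma locally_lipschitz_at_compose:
  assumes "locally_lipschitz_at F a" "locally_lipschitz_at H (F a)" shows "locally_lipschitz_at (\<lambda>x. H (F x)) a"
proof -
  obtain r L s M where *: "r > 0" "L-lipschitz_on (cball a r) F" "s > 0" "M-lipschitz_on (cball (F a) s) H"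
    using assms by (auto simp: locally_lipschitz_at_def)
  have L: "L \<ge> 0" using *(2) by (rule lipschitz_on_nonneg)
  \<comment> \<open>On this radius \<open>F\<close> stays within \<open>s\<close> of
    \<open>F a\<close>; the \<open>+ 1\<close> covers \<open>L = 0\<close>.\<close>
  define t where "t = min r (s / (L + 1))"
  have "(L + 1) * t \<le> (L + 1) * (s / (L + 1))"
    using L by (intro mult_left_mono) (auto simp: t_def)
  then have t: "t > 0" "t \<le> r" "(L + 1) * t \<le> s"
    using * L by (auto simp: t_def)
  have "F ` cball a t \<subseteq> cball (F a) s"
  proof safe
    fix x assume x: "x \<in> cball a t"
    have "dist (F a) (F x) \<le> L * dist a x"
      using lipschitz_onD[OF *(2)] x t by auto
    also have "\<dots> \<le> (L + 1) * t" using x L by (intro mult_mono) auto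
    finally show "F x \<in> cball (F a) s" using t by simp
  qed
  then have "(M * L)-lipschitz_on (cball a t) (\<lambda>x. H (F x))"
    using * t by (intro lipschitz_on_compose2 lipschitz_on_subset[OF *(2)] lipschitz_on_subset[OF *(4)]) auto
  then show ?thesis using t locally_lipschitz_at_def by blast
qed

lemma locally_lipschitz_at_scaleR:
  fixes H :: "'a::metric_space \<Rightarrow> 'b::real_normed_vector"
  assumes "locally_lipschitz_at f a" "locally_lipschitz_at H a" shows "locally_lipschitz_at (\<lambda>x. f x *\<^sub>R H x) a"
proof -
  obtain r L M where *: "r > 0" "L-lipschitz_on (cball a r) f" "M-lipschitz_on (cball a r) H"
    using locally_lipschitz_at_common_ball[OF assms] .
  have LM: "L \<ge> 0" "M \<ge> 0" using * lipschitz_on_nonneg by auto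
  have bd: "norm (f x) \<le> norm (f a) + L * r" "norm (H x) \<le> norm (H a) + M * r" if "x \<in> cball a r" for x
  proof -
    have xa: "dist x a \<le> r" "a \<in> cball a r" using that *(1) by (auto simp: dist_commute)
    have "norm (f x - f a) \<le> L * r"
      using lipschitz_onD[OF *(2) that xa(2)] mult_left_mono[OF xa(1) LM(1)] by (simp add: dist_norm)
    moreover have "norm (H x - H a) \<le> M * r"
      using lipschitz_onD[OF *(3) that xa(2)] mult_left_mono[OF xa(1) LM(2)] by (simp add: dist_norm)
    ultimately show "norm (f x) \<le> norm (f a) + L * r" "norm (H x) \<le> norm (H a) + M * r"
      using norm_triangle_sub[of "f x" "f a"] norm_triangle_sub[of "H x" "H a"] by linarith+
  qed
  define K where "K = (norm (f a) + L * r) * M + L * (norm (H a) + M * r)"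
  have "K-lipschitz_on (cball a r) (\<lambda>x. f x *\<^sub>R H x)"
  proof (rule lipschitz_onI)
    fix x y assume xy: "x \<in> cball a r" "y \<in> cball a r"
    have "f x *\<^sub>R H x - f y *\<^sub>R H y = f x *\<^sub>R (H x - H y) + (f x - f y) *\<^sub>R H y"
      by (simp add: algebra_simps)
    then have "norm (f x *\<^sub>R H x - f y *\<^sub>R H y) \<le> norm (f x) * norm (H x - H y) + norm (f x - f y) * norm (H y)"
      by (metis norm_triangle_ineq norm_scaleR real_norm_def)
    also have "\<dots> \<le> (norm (f a) + L * r) * (M * dist x y) + (L * dist x y) * (norm (H a) + M * r)"
      using bd xy lipschitz_onD[OF *(2) xy] lipschitz_onD[OF *(3) xy] LM *(1)
      by (intro add_mono mult_mono) (auto simp: dist_norm)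
    finally show "dist (f x *\<^sub>R H x) (f y *\<^sub>R H y) \<le> K * dist x y"
      by (simp add: dist_norm K_def algebra_simps)
  qed (use LM * in \<open>simp add: K_def\<close>)
  then show ?thesis using * locally_lipschitz_at_def by blast
qed

text \<open>The derivatives along the finitely many basis vectors are bounded on a compact ball, the
  sum of the bounds controls the operator norm, and the mean value inequality applies on the convex
  ball.\<close>

lemma smooth_on_locally_lipschitz_at:
  fixes f :: "'a::euclidean_space \<Rightarrow> 'b::real_normed_vector"
  assumes "smooth_on S f" "open S" "a \<in> S"
  shows "locally_lipschitz_at f a"
proof -
  obtain r where r: "r > 0" "cball a r \<subseteq> S" using assms open_contains_cball by blast
  let ?D = "\<lambda>x. frechet_derivative f (at x)"
  have "\<exists>B. \<forall>x\<in>cball a r. norm (?D x i) \<le> B" for i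
  proof -
    have "continuous_on (cball a r) (\<lambda>x. ?D x i)"
      using smooth_on_continuous[OF smooth_on_derivative[OF assms(1)]] r continuous_on_subset by blast
    then have "bounded ((\<lambda>x. ?D x i) ` cball a r)"
      by (intro compact_imp_bounded compact_continuous_image) auto
    then show ?thesis by (auto simp: bounded_iff)
  qed
  then obtain B where B: "\<And>i x. x \<in> cball a r \<Longrightarrow> norm (?D x i) \<le> B i" by metis
  have B0: "B i \<ge> 0" for i
    using order_trans[OF norm_ge_zero B[of a i]] r by simp
  define L where "L = (\<Sum>i\<in>Basis. B i)"
  have onb: "onorm (?D x) \<le> L" if x: "x \<in> cball a r" for x
  proof (rule onorm_le)
    fix v
    have lin: "linear (?D x)"
      using smooth_on_has_derivative[OF assms(1), of x] x r has_derivative_linear by blast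
    have "?D x v = ?D x (\<Sum>i\<in>Basis. (v \<bullet> i) *\<^sub>R i)" by (simp add: euclidean_representation)
    also have "\<dots> = (\<Sum>i\<in>Basis. (v \<bullet> i) *\<^sub>R ?D x i)" using lin by (simp add: linear_sum linear_scale)
    also have "norm \<dots> \<le> (\<Sum>i\<in>Basis. norm v * B i)"
      using B x by (intro sum_norm_le) (auto intro!: mult_mono Basis_le_norm)
    finally show "norm (?D x v) \<le> L * norm v"
      by (simp add: L_def sum_distrib_left mult.commute)
  qed
  have "norm (f x - f y) \<le> L * norm (x - y)" if "x \<in> cball a r" "y \<in> cball a r" for x y
  proof (rule differentiable_bound[OF convex_cball _ onb that])
    show "(f has_derivative ?D w) (at w within cball a r)" if "w \<in> cball a r" for w
      using smooth_on_has_derivative[OF assms(1) subsetD[OF r(2) that]] by (rule has_derivative_at_withinI)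
  qed
  moreover have "L \<ge> 0" unfolding L_def using B0 by (intro sum_nonneg)
  ultimately have "L-lipschitz_on (cball a r) f"
    by (auto simp: lipschitz_on_def dist_norm)
  then show ?thesis using r locally_lipschitz_at_def by blast
qed

text \<open>Serves for the Christoffel symbols and avoids inverting a matrix. The key identity is
  \<open>M p (z p - z q) = (b p - b q) - (M p (z q) - M q (z q))\<close>, whose left side controls
  \<open>z p - z q\<close> because \<open>M p\<close> is uniformly bounded below near
  \<open>a\<close>.\<close>

lemma locally_lipschitz_at_linear_solution:
  fixes M :: "'a::euclidean_space \<Rightarrow> 'e::euclidean_space \<Rightarrow> 'e"
  assumes lin': "\<And>p. p \<in> S \<Longrightarrow> linear (M p)" and M: "\<And>i. i \<in> Basis \<Longrightarrow> locally_lipschitz_at (\<lambda>p. M p i) a"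
    and inj: "inj (M a)" and b: "locally_lipschitz_at b a"
    and S: "open S" "a \<in> S" "\<And>p. p \<in> S \<Longrightarrow> M p (z p) = b p"
  shows "locally_lipschitz_at z a"
proof -
  obtain B where B: "B > 0" "\<And>h. B * norm h \<le> norm (M a h)"
    using linear_inj_bounded_below_pos[OF lin'[OF S(2)] inj] by blast
  have "\<exists>r L. r > 0 \<and> (i \<in> Basis \<longrightarrow> L-lipschitz_on (cball a r) (\<lambda>p. M p i))" for i
    using M[of i] zero_less_one unfolding locally_lipschitz_at_def by blast
  then obtain r L where r: "\<And>i. r i > 0"
    and L: "\<And>i. i \<in> Basis \<Longrightarrow> (L i)-lipschitz_on (cball a (r i)) (\<lambda>p. M p i)" by metis
  define K where "K = (\<Sum>i\<in>Basis. L i)"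
  have K: "K \<ge> 0" unfolding K_def using L lipschitz_on_nonneg by (intro sum_nonneg) blast
  obtain rb Lb where b': "rb > 0" "Lb-lipschitz_on (cball a rb) b"
    using b by (auto simp: locally_lipschitz_at_def)
  have Lb: "Lb \<ge> 0" using b'(2) by (rule lipschitz_on_nonneg)
  obtain rs where rs: "rs > 0" "cball a rs \<subseteq> S" using S open_contains_cball by blast
  \<comment> \<open>On this ball every Lipschitz bound is available, and
    \<open>K * R \<le> B / 2\<close>, so the lower bound \<open>B\<close> of \<open>M a\<close>
    drops to no less than \<open>B / 2\<close> for \<open>M p\<close>.\<close>
  define R where "R = Min (insert (B / (2 * (K + 1))) (insert rb (insert rs (r ` Basis))))"
  have R0: "R > 0" unfolding R_def using B K b' rs r by auto
  have Rle: "R \<le> B / (2 * (K + 1))" "R \<le> rb" "R \<le> rs" and Rr: "\<And>i. i \<in> Basis \<Longrightarrow> R \<le> r i"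
    unfolding R_def by (intro Min_le; simp)+
  have lin: "linear (M p)" if "p \<in> cball a R" for p
    using lin'[OF subsetD[OF rs(2)]] that Rle by auto
  have KR: "K * R \<le> B / 2"
  proof -
    have "K * R \<le> (K + 1) * (B / (2 * (K + 1)))" using K R0 Rle by (intro mult_mono) auto
    also have "\<dots> = B / 2" using K by (simp add: divide_simps)
    finally show ?thesis .
  qed
  have dM: "norm (M p h - M q h) \<le> K * dist p q * norm h" if pq: "p \<in> cball a R" "q \<in> cball a R" for p q h
  proof -
    have rep: "M p h = (\<Sum>i\<in>Basis. (h \<bullet> i) *\<^sub>R M p i)" if "p \<in> cball a R" for p
      using linear_sum[OF lin[OF that], of "\<lambda>i. (h \<bullet> i) *\<^sub>R i" Basis]
      by (simp add: euclidean_representation linear_scale[OF lin[OF that]])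
    have "M p h - M q h = (\<Sum>i\<in>Basis. (h \<bullet> i) *\<^sub>R (M p i - M q i))"
      by (simp add: rep[OF pq(1)] rep[OF pq(2)] sum_subtractf scaleR_diff_right)
    also have "norm \<dots> \<le> (\<Sum>i\<in>Basis. norm h * (L i * dist p q))"
    proof (rule sum_norm_le)
      fix i :: 'e assume i: "i \<in> Basis"
      have "dist (M p i) (M q i) \<le> L i * dist p q"
        using pq Rr[OF i] by (intro lipschitz_onD[OF L[OF i]]) auto
      then show "norm ((h \<bullet> i) *\<^sub>R (M p i - M q i)) \<le> norm h * (L i * dist p q)"
        using Basis_le_norm[OF i, of h] by (auto simp: dist_norm intro!: mult_mono)
    qed
    also have "\<dots> = K * dist p q * norm h"
      by (simp add: K_def sum_distrib_left sum_distrib_right mult_ac)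
    finally show ?thesis .
  qed
  have low: "B / 2 * norm h \<le> norm (M p h)" if p: "p \<in> cball a R" for p h
  proof -
    have "norm (M a h) \<le> norm (M p h) + norm (M a h - M p h)" by (rule norm_triangle_sub)
    also have "norm (M a h - M p h) \<le> K * dist a p * norm h" using dM[of a p] p R0 by auto
    also have "\<dots> \<le> K * R * norm h" using p K by (intro mult_right_mono mult_left_mono) auto
    also have "\<dots> \<le> B / 2 * norm h" using KR by (intro mult_right_mono) auto
    finally have "norm (M a h) \<le> norm (M p h) + B / 2 * norm h" by simp
    moreover have "B * norm h \<le> norm (M a h)" by (rule B(2))
    moreover have "B * norm h = B / 2 * norm h + B / 2 * norm h" by simp
    ultimately show ?thesis by linarith
  qed
  have db: "norm (b p - b q) \<le> Lb * dist p q" if "p \<in> cball a R" "q \<in> cball a R" for p q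
    using lipschitz_onD[OF b'(2), of p q] that Rle by (auto simp: dist_norm)
  define C where "C = norm (b a) + Lb * R"
  have C: "C \<ge> 0" using Lb R0 by (simp add: C_def)
  have Mz: "M p (z p) = b p" if "p \<in> cball a R" for p
    using S(3)[OF subsetD[OF rs(2)]] that Rle by auto
  have zb: "B / 2 * norm (z p) \<le> C" if p: "p \<in> cball a R" for p
  proof -
    have "norm (b p) \<le> norm (b a) + norm (b p - b a)" by (rule norm_triangle_sub)
    also have "norm (b p - b a) \<le> Lb * dist p a" using db[of p a] p R0 by auto
    also have "\<dots> \<le> Lb * R" using p Lb by (intro mult_left_mono) (auto simp: dist_commute)
    finally show ?thesis using low[OF p, of "z p"] Mz[OF p] by (simp add: C_def)
  qed
  define Q where "Q = (2 / B) * (Lb + K * (2 / B * C))"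
  have "dist (z p) (z q) \<le> Q * dist p q" if pq: "p \<in> cball a R" "q \<in> cball a R" for p q
  proof -
    have "M p (z p - z q) = (b p - b q) - (M p (z q) - M q (z q))"
      using Mz pq by (simp add: linear_diff[OF lin[OF pq(1)]])
    then have "norm (M p (z p - z q)) \<le> norm (b p - b q) + norm (M p (z q) - M q (z q))"
      using norm_triangle_ineq4 by metis
    also have "\<dots> \<le> Lb * dist p q + K * dist p q * norm (z q)" using db dM pq by (intro add_mono)
    also have "\<dots> \<le> Lb * dist p q + K * dist p q * (2 / B * C)"
      using zb[OF pq(2)] B(1) K by (intro add_left_mono mult_left_mono) (auto simp: field_simps)
    also have "\<dots> = (Lb + K * (2 / B * C)) * dist p q" by (simp add: algebra_simps)
    finally have "B / 2 * norm (z p - z q) \<le> (Lb + K * (2 / B * C)) * dist p q"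
      by (rule order_trans[OF low[OF pq(1)]])
    then have "(2 / B) * (B / 2 * norm (z p - z q)) \<le> (2 / B) * ((Lb + K * (2 / B * C)) * dist p q)"
      using B(1) by (intro mult_left_mono) auto
    moreover have "(2 / B) * (B / 2 * norm (z p - z q)) = dist (z p) (z q)"
      using B(1) by (simp add: dist_norm)
    ultimately show ?thesis by (simp only: Q_def mult.assoc)
  qed
  moreover have "Q \<ge> 0" using B(1) K C Lb by (simp add: Q_def)
  ultimately have "Q-lipschitz_on (cball a R) z" by (rule lipschitz_onI)
  then show ?thesis using R0 locally_lipschitz_at_def by blast
qed

section \<open>Charts and metric coefficients\<close>

lemma bilinear_expand:
  fixes B :: "'e::euclidean_space \<Rightarrow> 'e \<Rightarrow> real"
  assumes "bilinear B"
  shows "B u w = (\<Sum>i\<in>Basis. \<Sum>j\<in>Basis. (u \<bullet> i) * (w \<bullet> j) * B i j)"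
proof -
  have "B u w = B (\<Sum>i\<in>Basis. (u \<bullet> i) *\<^sub>R i) (\<Sum>j\<in>Basis. (w \<bullet> j) *\<^sub>R j)"
    by (simp add: euclidean_representation)
  also have "\<dots> = (\<Sum>(i,j)\<in>Basis \<times> Basis. B ((u \<bullet> i) *\<^sub>R i) ((w \<bullet> j) *\<^sub>R j))"
    by (rule bilinear_sum[OF assms])
  also have "\<dots> = (\<Sum>i\<in>Basis. \<Sum>j\<in>Basis. (u \<bullet> i) * (w \<bullet> j) * B i j)"
    by (simp add: sum.cartesian_product bilinear_lmul[OF assms] bilinear_rmul[OF assms] mult_ac)
  finally show ?thesis .
qed

text \<open>Each linearity identity holds for all forms near \<open>x\<close>, so uniqueness of
  derivatives transfers it to \<open>D\<close>.\<close>

lemma bilinear_derivative: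
  fixes G :: "'a::real_normed_vector \<Rightarrow> 'e::real_vector \<Rightarrow> 'e \<Rightarrow> real"
  assumes "open S" "x \<in> S" and G: "\<And>y. y \<in> S \<Longrightarrow> bilinear (G y)"
    and D: "\<And>u w. ((\<lambda>y. G y u w) has_derivative D u w) (at x)"
  shows "bilinear (\<lambda>u w. D u w v)"
proof -
  have eq: "D u w = F"
    if "(f has_derivative F) (at x)" "\<And>y. y \<in> S \<Longrightarrow> f y = G y u w" for f F u w
    using has_derivative_unique[OF D has_derivative_transform_within_open[OF that(1) assms(1,2) that(2)]] .
  have "D (u + u') w = (\<lambda>v. D u w v + D u' w v)" for u u' w
    by (rule eq[OF has_derivative_add[OF D D]]) (simp add: bilinear_ladd[OF G])
  moreover have "D (r *\<^sub>R u) w = (\<lambda>v. r *\<^sub>R D u w v)" for r u w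
    by (rule eq[OF has_derivative_scaleR_right[OF D]]) (simp add: bilinear_lmul[OF G])
  moreover have "D w (u + u') = (\<lambda>v. D w u v + D w u' v)" for u u' w
    by (rule eq[OF has_derivative_add[OF D D]]) (simp add: bilinear_radd[OF G])
  moreover have "D w (r *\<^sub>R u) = (\<lambda>v. r *\<^sub>R D w u v)" for r u w
    by (rule eq[OF has_derivative_scaleR_right[OF D]]) (simp add: bilinear_rmul[OF G])
  ultimately show ?thesis
    by (simp add: bilinear_def linear_iff)
qed

text \<open>A product rule for a form that varies together with its arguments. Differentiability in
  the base point is given only for fixed vectors, so everything is expanded in the basis into
  products of real functions.\<close>

lemma has_derivative_bilinear_form:
  fixes G :: "'a::real_normed_vector \<Rightarrow> 'e::euclidean_space \<Rightarrow> 'e \<Rightarrow> real"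
  assumes S: "open S" "p t \<in> S" and G: "\<And>y. y \<in> S \<Longrightarrow> bilinear (G y)"
    and D: "\<And>u w. ((\<lambda>y. G y u w) has_derivative D u w) (at (p t))"
    and p: "(p has_derivative p') (at t)" and q: "(q has_derivative q') (at t)"
    and r: "(r has_derivative r') (at t)"
  shows "((\<lambda>s. G (p s) (q s) (r s)) has_derivative
    (\<lambda>h. D (q t) (r t) (p' h) + G (p t) (q' h) (r t) + G (p t) (q t) (r' h))) (at t)"
proof -
  let ?d = "\<lambda>i j h. (q t \<bullet> i) * (r t \<bullet> j) * D i j (p' h)
      + (q' h \<bullet> i) * (r t \<bullet> j) * G (p t) i j + (q t \<bullet> i) * (r' h \<bullet> j) * G (p t) i j"
  have comp: "((\<lambda>s. G (p s) i j) has_derivative (\<lambda>h. D i j (p' h))) (at t)" for i j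
    by (rule has_derivative_compose[OF p, where g = "\<lambda>y. G y i j", OF D])
  have 1: "((\<lambda>s. \<Sum>i\<in>Basis. \<Sum>j\<in>Basis. (q s \<bullet> i) * (r s \<bullet> j) * G (p s) i j) has_derivative
      (\<lambda>h. \<Sum>i\<in>Basis. \<Sum>j\<in>Basis. ?d i j h)) (at t)"
  proof (intro has_derivative_sum)
    fix i j :: 'e
    have "((\<lambda>s. (q s \<bullet> i) * (r s \<bullet> j) * G (p s) i j) has_derivative
        (\<lambda>h. (q t \<bullet> i) * (r t \<bullet> j) * D i j (p' h)
          + ((q t \<bullet> i) * (r' h \<bullet> j) + (q' h \<bullet> i) * (r t \<bullet> j)) * G (p t) i j)) (at t)"
      by (intro has_derivative_mult comp has_derivative_inner_left q r)
    then show "((\<lambda>s. (q s \<bullet> i) * (r s \<bullet> j) * G (p s) i j) has_derivative ?d i j) (at t)"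
      by (simp add: algebra_simps)
  qed
  \<comment> \<open>Needed to fold the first double sum back into
    \<open>D (q t) (r t)\<close>.\<close>
  have bD: "bilinear (\<lambda>u w. D u w v)" for v
    by (rule bilinear_derivative[OF S G D])
  have 2: "(\<Sum>i\<in>Basis. \<Sum>j\<in>Basis. ?d i j h) =
      D (q t) (r t) (p' h) + G (p t) (q' h) (r t) + G (p t) (q t) (r' h)" for h
    unfolding sum.distrib bilinear_expand[OF bD, of "q t" "r t"]
      bilinear_expand[OF G[OF S(2)], of "q' h" "r t"] bilinear_expand[OF G[OF S(2)], of "q t" "r' h"] ..
  have "\<forall>\<^sub>F s in nhds t. p s \<in> S"
    using has_derivative_continuous[OF p] S
    unfolding isCont_def tendsto_at_iff_tendsto_nhds by (auto dest: topological_tendstoD)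
  then obtain T where T: "open T" "t \<in> T" "\<And>s. s \<in> T \<Longrightarrow> p s \<in> S"
    unfolding eventually_nhds by blast
  have "((\<lambda>s. G (p s) (q s) (r s)) has_derivative (\<lambda>h. \<Sum>i\<in>Basis. \<Sum>j\<in>Basis. ?d i j h)) (at t)"
    by (rule has_derivative_transform_within_open[OF 1 T(1,2)])
      (rule bilinear_expand[OF G[OF T(3)], symmetric])
  then show ?thesis unfolding 2 .
qed

text \<open>Riesz representation in finite dimension: positivity makes \<open>N\<close>, the vector
  of values on the basis, injective and hence surjective.\<close>

lemma inner_form_representation:
  fixes B :: "'e::euclidean_space \<Rightarrow> 'e \<Rightarrow> real"
  assumes B: "bilinear B" and pos: "\<And>u. u \<noteq> 0 \<Longrightarrow> B u u > 0" and L: "linear L"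
  shows "\<exists>!z. \<forall>w. B z w = L w"
proof (rule ex_ex1I)
  define N where "N z = (\<Sum>i\<in>Basis. B z i *\<^sub>R i)" for z
  have N: "N z \<bullet> i = B z i" if "i \<in> Basis" for z i
    unfolding N_def using that by (rule inner_sum_left_Basis)
  have eq: "\<forall>w. B z w = L' w" if "linear L'" "\<And>i. i \<in> Basis \<Longrightarrow> B z i = L' i" for z L'
  proof -
    have "linear (B z)" using B by (simp add: bilinear_def)
    then have "B z = L'" using that linear_eq_stdbasis by blast
    then show ?thesis by simp
  qed
  have "linear N"
    unfolding N_def
    by (rule linearI) (simp_all add: bilinear_ladd[OF B] bilinear_lmul[OF B] sum.distrib scaleR_add_left scaleR_sum_right)
  moreover have "inj N"
    unfolding linear_injective_0[OF \<open>linear N\<close>]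
  proof safe
    fix z assume "N z = 0"
    then have "\<And>i. i \<in> Basis \<Longrightarrow> B z i = 0" using N[of _ z] by simp
    then have "B z z = 0" using eq[OF linear_zero, of z] by simp
    then show "z = 0" using pos[of z] by (cases "z = 0") auto
  qed
  ultimately have "surj N" by (intro linear_injective_imp_surjective) auto
  then obtain z where "N z = (\<Sum>i\<in>Basis. L i *\<^sub>R i)" by (metis surjD)
  then have "B z i = L i" if "i \<in> Basis" for i
    using N[OF that, of z] inner_sum_left_Basis[OF that, of L] by simp
  then show "\<exists>z. \<forall>w. B z w = L w" using eq[OF L] by blast
  show "z = z'" if "\<forall>w. B z w = L w" "\<forall>w. B z' w = L w" for z z'
  proof (rule ccontr)
    assume "z \<noteq> z'"
    then have "B (z - z') (z - z') > 0" using pos by simp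
    then show False using that by (simp add: bilinear_lsub[OF B])
  qed
qed

locale riemannian_manifold =
  fixes A :: "('m::{t2_space, second_countable_topology}, 'e::euclidean_space) chart set"
    and g :: "('m, 'e) metric"
  assumes atlas: "smooth_atlas A" and riemannian: "riemannian_metric A g"
begin

section \<open>Charts and coordinates of tangent vectors\<close>

lemma chart_at: obtains c where "c \<in> A" "p \<in> chart_dom c"
  using atlas unfolding smooth_atlas_def by (metis UNIV_I UN_E)

lemma
  assumes "c \<in> A"
  shows open_chart_dom: "open (chart_dom c)" and open_chart_image: "open (chart_image c)"
    and homeomorphism_chart: "homeomorphism (chart_dom c) (chart_image c) (chart_map c) (chart_inv c)"
  using assms atlas unfolding smooth_atlas_def is_chart_def by auto

lemma chart_inv_map [simp]: "c \<in> A \<Longrightarrow> p \<in> chart_dom c \<Longrightarrow> chart_inv c (chart_map c p) = p"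
  using homeomorphism_chart homeomorphism_apply1 by metis

lemma chart_map_inv [simp]: "c \<in> A \<Longrightarrow> x \<in> chart_image c \<Longrightarrow> chart_map c (chart_inv c x) = x"
  using homeomorphism_chart homeomorphism_apply2 by metis

lemma chart_map_image [simp]: "p \<in> chart_dom c \<Longrightarrow> chart_map c p \<in> chart_image c"
  by (simp add: chart_image_def)

lemma chart_inv_dom [simp]: "c \<in> A \<Longrightarrow> x \<in> chart_image c \<Longrightarrow> chart_inv c x \<in> chart_dom c"
  using homeomorphism_chart unfolding homeomorphism_def by blast

lemma isCont_chart_map: "c \<in> A \<Longrightarrow> p \<in> chart_dom c \<Longrightarrow> isCont (chart_map c) p"
  using homeomorphism_chart[of c] open_chart_dom[of c]
  by (auto simp: homeomorphism_def continuous_on_eq_continuous_at)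

lemma isCont_chart_inv: "c \<in> A \<Longrightarrow> x \<in> chart_image c \<Longrightarrow> isCont (chart_inv c) x"
  using homeomorphism_chart[of c] open_chart_image[of c]
  by (auto simp: homeomorphism_def continuous_on_eq_continuous_at)

lemma open_chart_map_image:
  assumes c: "c \<in> A" and U: "open U"
  shows "open (chart_map c ` (chart_dom c \<inter> U))"
proof -
  have "chart_map c ` (chart_dom c \<inter> U) = chart_image c \<inter> chart_inv c -` U"
  proof (intro equalityI subsetI)
    fix x assume "x \<in> chart_image c \<inter> chart_inv c -` U"
    then show "x \<in> chart_map c ` (chart_dom c \<inter> U)"
      using c by (intro image_eqI[of _ _ "chart_inv c x"]) auto
  qed (use c in auto)
  moreover have "continuous_on (chart_image c) (chart_inv c)"
    using homeomorphism_chart[OF c] by (simp add: homeomorphism_def)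
  ultimately show ?thesis
    using U open_chart_image[OF c] by (simp add: continuous_on_open_vimage Int_commute)
qed

lemma transition_has_derivative:
  assumes "c \<in> A" "d \<in> A" "p \<in> chart_dom c" "p \<in> chart_dom d"
  shows "(chart_map d \<circ> chart_inv c has_derivative
    frechet_derivative (chart_map d \<circ> chart_inv c) (at (chart_map c p))) (at (chart_map c p))"
proof (rule smooth_on_has_derivative)
  show "smooth_on (chart_map c ` (chart_dom c \<inter> chart_dom d)) (chart_map d \<circ> chart_inv c)"
    using assms atlas unfolding smooth_atlas_def by blast
qed (use assms in auto)

text \<open>The chain rule through a change of chart. It yields the cocycle rule for transition maps
  and, later, frees \<open>differential\<close> from its arbitrarily chosen chart.\<close>

lemma transition_compose:
  assumes "c \<in> A" "d \<in> A" "p \<in> chart_dom c" "p \<in> chart_dom d"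
    and f: "(f \<circ> chart_inv d has_derivative f') (at (chart_map d p))"
  shows "(f \<circ> chart_inv c has_derivative
    (\<lambda>u. f' (frechet_derivative (chart_map d \<circ> chart_inv c) (at (chart_map c p)) u))) (at (chart_map c p))"
proof -
  let ?t = "chart_map d \<circ> chart_inv c"
  have "?t (chart_map c p) = chart_map d p" using assms by simp
  then have "(f \<circ> chart_inv d \<circ> ?t has_derivative f' \<circ> frechet_derivative ?t (at (chart_map c p))) (at (chart_map c p))"
    using f by (intro diff_chain_at transition_has_derivative assms) simp
  then have "(f \<circ> chart_inv c has_derivative f' \<circ> frechet_derivative ?t (at (chart_map c p))) (at (chart_map c p))"
  proof (rule has_derivative_transform_within_open)
    show "open (chart_map c ` (chart_dom c \<inter> chart_dom d))"
      using assms open_chart_map_image open_chart_dom by blast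
  qed (use assms in auto)
  then show ?thesis by (simp add: o_def)
qed

lemma transition_cocycle:
  assumes "c \<in> A" "d \<in> A" "e \<in> A" "p \<in> chart_dom c" "p \<in> chart_dom d" "p \<in> chart_dom e"
  shows "frechet_derivative (chart_map e \<circ> chart_inv c) (at (chart_map c p)) u =
    frechet_derivative (chart_map e \<circ> chart_inv d) (at (chart_map d p))
      (frechet_derivative (chart_map d \<circ> chart_inv c) (at (chart_map c p)) u)"
  using frechet_derivative_at[OF transition_compose[OF assms(1,2,4,5) transition_has_derivative[OF assms(2,3,5,6)]]]
  by (metis (no_types, lifting))

lemma transition_self:
  assumes "c \<in> A" "p \<in> chart_dom c"
  shows "frechet_derivative (chart_map c \<circ> chart_inv c) (at (chart_map c p)) u = u"
proof -
  have "(chart_map c \<circ> chart_inv c has_derivative (\<lambda>u. u)) (at (chart_map c p))"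
    by (rule has_derivative_transform_within_open[OF has_derivative_ident open_chart_image[OF assms(1)]])
      (use assms in auto)
  from frechet_derivative_at[OF this] show ?thesis by metis
qed

lemma coord_vector_in_tangent_space:
  assumes "c \<in> A" "p \<in> chart_dom c"
  shows "coord_vector A c p u \<in> tangent_space A p"
  unfolding tangent_space_def coord_vector_def using assms by (auto intro: transition_cocycle)

lemma coord_vector_self: "c \<in> A \<Longrightarrow> p \<in> chart_dom c \<Longrightarrow> coord_vector A c p u c = u"
  by (simp add: coord_vector_def transition_self)

lemma tangent_vector_eq_coord_vector:
  assumes "c \<in> A" "p \<in> chart_dom c" "v \<in> tangent_space A p"
  shows "v = coord_vector A c p (v c)"
proof (rule ext)
  fix d
  have "v d = frechet_derivative (chart_map d \<circ> chart_inv c) (at (chart_map c p)) (v c)"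
    if "d \<in> A" "p \<in> chart_dom d"
    using assms that unfolding tangent_space_def by blast
  moreover have "v d = 0" if "\<not> (d \<in> A \<and> p \<in> chart_dom d)"
    using assms(3) that unfolding tangent_space_def by blast
  ultimately show "v d = coord_vector A c p (v c) d"
    unfolding coord_vector_def by argo
qed

lemma coord_vector_add:
  assumes "c \<in> A" "p \<in> chart_dom c"
  shows "coord_vector A c p (u + w) = coord_vector A c p u + coord_vector A c p w"
  unfolding coord_vector_def plus_fun_def
  using has_derivative_linear[OF transition_has_derivative] assms by (intro ext) (auto simp: linear_add)

lemma coord_vector_scaleR:
  assumes "c \<in> A" "p \<in> chart_dom c"
  shows "coord_vector A c p (r *\<^sub>R u) = r *\<^sub>R coord_vector A c p u"
  unfolding coord_vector_def scaleR_fun_def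
  using has_derivative_linear[OF transition_has_derivative] assms by (intro ext) (auto simp: linear_scale)

lemma inner_product_tangent: "inner_product_on (tangent_space A p) (g p)"
  using riemannian by (simp add: riemannian_metric_def)

section \<open>Metric coefficients, their derivatives and the Christoffel symbols\<close>

abbreviation "G \<equiv> metric_coord A g"

definition "D c x u w = frechet_derivative (\<lambda>y. G c y u w) (at x)"

lemma metric_sym:
  assumes "c \<in> A" "x \<in> chart_image c" shows "G c x u w = G c x w u"
  unfolding metric_coord_def using inner_product_tangent assms coord_vector_in_tangent_space
  unfolding inner_product_on_def by simp

lemma metric_bilinear:
  assumes "c \<in> A" "x \<in> chart_image c" shows "bilinear (G c x)"
proof -
  let ?p = "chart_inv c x"
  have "G c x (u + u') w = G c x u w + G c x u' w" "G c x (r *\<^sub>R u) w = r * G c x u w" for u u' w r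
    using inner_product_tangent[of ?p] coord_vector_in_tangent_space[of c ?p] assms
    unfolding metric_coord_def inner_product_on_def by (simp_all add: coord_vector_add coord_vector_scaleR)
  then show ?thesis
    unfolding bilinear_def linear_iff by (simp add: metric_sym[OF assms])
qed

lemma metric_pos:
  assumes "c \<in> A" "x \<in> chart_image c" "u \<noteq> 0" shows "G c x u u > 0"
proof -
  have "coord_vector A c (chart_inv c x) u \<noteq> 0"
    using coord_vector_self[of c "chart_inv c x" u] assms by auto
  then show ?thesis
    using inner_product_tangent coord_vector_in_tangent_space assms
    unfolding metric_coord_def inner_product_on_def by simp
qed

lemma metric_eq_coord:
  assumes "c \<in> A" "p \<in> chart_dom c" "v \<in> tangent_space A p" "w \<in> tangent_space A p"
  shows "g p v w = G c (chart_map c p) (v c) (w c)"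
  using assms by (simp add: metric_coord_def flip: tangent_vector_eq_coord_vector)

lemma smooth_metric: "c \<in> A \<Longrightarrow> smooth_on (chart_image c) (\<lambda>y. G c y u w)"
  using riemannian by (simp add: riemannian_metric_def)

lemma metric_has_derivative:
  "c \<in> A \<Longrightarrow> x \<in> chart_image c \<Longrightarrow> ((\<lambda>y. G c y u w) has_derivative D c x u w) (at x)"
  unfolding D_def by (rule smooth_on_has_derivative[OF smooth_metric])

lemma D_linear: "c \<in> A \<Longrightarrow> x \<in> chart_image c \<Longrightarrow> linear (D c x u w)"
  using metric_has_derivative has_derivative_linear by blast

lemma D_bilinear:
  assumes "c \<in> A" "x \<in> chart_image c" shows "bilinear (\<lambda>u w. D c x u w v)"
  by (rule bilinear_derivative[OF open_chart_image[OF assms(1)] assms(2)])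
    (use assms metric_bilinear metric_has_derivative in auto)

lemma D_sym:
  assumes "c \<in> A" "x \<in> chart_image c" shows "D c x u w = D c x w u"
proof -
  have "((\<lambda>y. G c y u w) has_derivative D c x w u) (at x)"
    by (rule has_derivative_transform_within_open[OF metric_has_derivative open_chart_image])
      (use assms metric_sym in auto)
  then show ?thesis using metric_has_derivative[OF assms] has_derivative_unique by blast
qed

text \<open>The right-hand side is linear in \<open>w\<close>, so exactly one vector represents it,
  and the \<open>THE\<close> in \<open>christoffel\<close> picks that vector.\<close>

lemma metric_christoffel:
  assumes "c \<in> A" "x \<in> chart_image c"
  shows "G c x (christoffel A g c x u v) w = (D c x v w u + D c x u w v - D c x u v w) / 2"
proof -
  have "linear (\<lambda>w. D c x v w u + D c x u w v - D c x u v w)"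
    using D_linear[OF assms] D_bilinear[OF assms] unfolding bilinear_def
    by (intro linear_compose_add linear_compose_sub) auto
  then have "linear (\<lambda>w. (1/2) *\<^sub>R (D c x v w u + D c x u w v - D c x u v w))"
    by (rule linear_compose_scale_right)
  then have "linear (\<lambda>w. (D c x v w u + D c x u w v - D c x u v w) / 2)" by simp
  from inner_form_representation[OF metric_bilinear[OF assms] metric_pos[OF assms] this]
  have "\<forall>w. G c x (christoffel A g c x u v) w = (D c x v w u + D c x u w v - D c x u v w) / 2"
    unfolding christoffel_def D_def by (rule theI')
  then show ?thesis by blast
qed

end

section \<open>Existence of maximal geodesics\<close>

text \<open>The condition at a single time involves the curve only near that time; this locality is
  what lets geodesics be glued along a chain.\<close>

definition geodesic_at ::
  "('m::topological_space, 'e::euclidean_space) chart set \<Rightarrow> ('m, 'e) metric \<Rightarrow> (real \<Rightarrow> 'm) \<Rightarrow> real \<Rightarrow> bool"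
  where "geodesic_at A g \<gamma> t \<longleftrightarrow> isCont \<gamma> t \<and>
    (\<exists>c\<in>A. \<gamma> t \<in> chart_dom c \<and>
       (\<exists>v. (\<forall>\<^sub>F s in nhds t. ((chart_map c \<circ> \<gamma>) has_vector_derivative v s) (at s)) \<and>
            (v has_vector_derivative - christoffel A g c (chart_map c (\<gamma> t)) (v t) (v t)) (at t)))"

lemma geodesic_iff:
  "geodesic A g J \<gamma> \<longleftrightarrow> open J \<and> is_interval J \<and> J \<noteq> {} \<and> (\<forall>t\<in>J. geodesic_at A g \<gamma> t)"
  unfolding geodesic_def geodesic_at_def by (auto simp: continuous_on_eq_continuous_at)

lemma geodesic_at_cong:
  assumes "geodesic_at A g \<gamma> t" "open T" "t \<in> T" and eq: "\<And>s. s \<in> T \<Longrightarrow> \<gamma> s = \<gamma>' s"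
  shows "geodesic_at A g \<gamma>' t"
proof -
  obtain c v where cv: "c \<in> A" "\<gamma> t \<in> chart_dom c"
    "\<forall>\<^sub>F s in nhds t. ((chart_map c \<circ> \<gamma>) has_vector_derivative v s) (at s)"
    "(v has_vector_derivative - christoffel A g c (chart_map c (\<gamma> t)) (v t) (v t)) (at t)"
    using assms(1) by (auto simp: geodesic_at_def)
  have "\<forall>\<^sub>F s in nhds t. s \<in> T" using assms(2,3) by (rule eventually_nhds_in_open)
  with cv(3) have "\<forall>\<^sub>F s in nhds t. ((chart_map c \<circ> \<gamma>') has_vector_derivative v s) (at s)"
  proof eventually_elim
    case (elim s)
    show ?case
      by (rule has_vector_derivative_transform_within_open[OF elim(1) assms(2) elim(2)]) (simp add: eq)
  qed
  moreover have "isCont \<gamma>' t"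
  proof -
    have "\<forall>\<^sub>F s in nhds t. \<gamma> s = \<gamma>' s"
      using assms(2,3) eq eventually_nhds by blast
    then show ?thesis using assms(1) isCont_cong unfolding geodesic_at_def by blast
  qed
  ultimately show ?thesis
    using cv eq[OF assms(3)] unfolding geodesic_at_def by auto
qed

text \<open>Zorn's lemma for the geodesics extending the given one. The union of a chain is again a
  geodesic because the condition is local and the domains all contain \<open>J\<close>.\<close>

lemma geodesic_extends_to_maximal:
  assumes geo: "geodesic A g J \<gamma>"
  obtains J' \<gamma>' where "maximal_geodesic A g J' \<gamma>'" "J \<subseteq> J'" "\<And>t. t \<in> J \<Longrightarrow> \<gamma>' t = \<gamma> t"
proof -
  \<comment> \<open>For graphs, extension of curves is set inclusion, and the irrelevant values
    outside the domain disappear.\<close>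
  define graph where "graph K \<delta> = (\<lambda>t. (t, \<delta> t)) ` K" for K and \<delta> :: "real \<Rightarrow> 'a"
  have fst_graph: "fst ` graph K \<delta> = K" for K \<delta> by (force simp: graph_def image_image)
  define E where "E = {graph K \<delta> |K \<delta>. geodesic A g K \<delta> \<and> J \<subseteq> K \<and> (\<forall>t\<in>J. \<delta> t = \<gamma> t)}"
  have "\<exists>M\<in>E. \<forall>X\<in>E. M \<subseteq> X \<longrightarrow> X = M"
  proof (rule subset_Zorn_nonempty)
    have "graph J \<gamma> \<in> E" unfolding E_def using geo by blast
    then show "E \<noteq> {}" by blast
    fix C assume "C \<noteq> {}" and chain: "subset.chain E C"
    have CE: "\<exists>K \<delta>. R = graph K \<delta> \<and> geodesic A g K \<delta> \<and> J \<subseteq> K \<and> (\<forall>t\<in>J. \<delta> t = \<gamma> t)" if "R \<in> C" for R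
      using chain that unfolding subset.chain_def E_def by blast
    have uniq: "y = z" if yz: "(t, y) \<in> \<Union>C" "(t, z) \<in> \<Union>C" for t y z
    proof -
      obtain R R' where R: "R \<in> C" "R' \<in> C" "(t, y) \<in> R" "(t, z) \<in> R'" using yz by blast
      then have "R \<subseteq> R' \<or> R' \<subseteq> R" using chain unfolding subset.chain_def by blast
      then obtain Q where "Q \<in> C" "(t, y) \<in> Q" "(t, z) \<in> Q" using R by blast
      then show ?thesis using CE[of Q] by (auto simp: graph_def)
    qed
    define K where "K = fst ` \<Union>C"
    define \<delta> where "\<delta> t = (THE y. (t, y) \<in> \<Union>C)" for t
    have \<delta>: "\<delta> t = y" if "(t, y) \<in> \<Union>C" for t y
      unfolding \<delta>_def using that uniq by blast
    have U: "\<Union>C = graph K \<delta>"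
    proof (intro equalityI subsetI)
      fix q assume q: "q \<in> \<Union>C"
      have "fst q \<in> K" unfolding K_def by (rule imageI[OF q])
      moreover have "\<delta> (fst q) = snd q" by (rule \<delta>) (unfold prod.collapse, rule q)
      ultimately show "q \<in> graph K \<delta>" unfolding graph_def by (intro image_eqI[where x = "fst q"]) simp_all
    next
      fix q assume "q \<in> graph K \<delta>"
      then obtain t where t: "q = (t, \<delta> t)" "t \<in> K" unfolding graph_def by blast
      obtain q' where "t = fst q'" "q' \<in> \<Union>C"
        using t(2) unfolding K_def by (rule imageE)
      then have y: "(t, snd q') \<in> \<Union>C" by (simp only: prod.collapse)
      show "q \<in> \<Union>C" unfolding t(1) \<delta>[OF y] by (rule y)
    qed
    have K: "K = (\<Union>R\<in>C. fst ` R)" unfolding K_def by blast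
    have dom: "open (fst ` R)" "connected (fst ` R)" "J \<subseteq> fst ` R" if "R \<in> C" for R
      using CE[OF that] by (auto simp: fst_graph geodesic_iff is_interval_connected_1)
    have "J \<noteq> {}" using geo by (simp add: geodesic_iff)
    obtain R0 where R0: "R0 \<in> C" using \<open>C \<noteq> {}\<close> by blast
    have "J \<subseteq> K" unfolding K by (rule order_trans[OF dom(3)[OF R0]]) (rule UN_upper[OF R0])
    have "open K" unfolding K by (intro open_UN ballI dom(1))
    \<comment> \<open>A point common to all domains makes their union connected, hence an
      interval.\<close>
    obtain t0 where "t0 \<in> J" using \<open>J \<noteq> {}\<close> by blast
    have "t0 \<in> \<Inter>((`) fst ` C)" using subsetD[OF dom(3) \<open>t0 \<in> J\<close>] by simp
    then have "\<Inter>((`) fst ` C) \<noteq> {}" by (rule ex_in_conv[THEN iffD1, OF exI])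
    then have "connected K"
      unfolding K by (rule connected_Union[rotated]) (use dom(2) in auto)
    moreover have "geodesic_at A g \<delta> t" if "t \<in> K" for t
    proof -
      obtain R where R: "R \<in> C" "t \<in> fst ` R" using \<open>t \<in> K\<close> K by blast
      obtain L \<epsilon> where L: "R = graph L \<epsilon>" "geodesic A g L \<epsilon>" using CE[OF R(1)] by blast
      have "t \<in> L" using R(2) unfolding L fst_graph .
      have "\<epsilon> s = \<delta> s" if "s \<in> L" for s
        using that R(1) L(1) by (intro \<delta>[symmetric]) (auto simp: graph_def)
      then show ?thesis
        using L(2) \<open>t \<in> L\<close> geodesic_at_cong unfolding geodesic_iff by blast
    qed
    ultimately have "geodesic A g K \<delta>"
      unfolding geodesic_iff using \<open>J \<noteq> {}\<close> \<open>J \<subseteq> K\<close> \<open>open K\<close>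
      by (auto simp: is_interval_connected_1)
    moreover have "\<delta> t = \<gamma> t" if t: "t \<in> J" for t
    proof -
      obtain R where R: "R \<in> C" using \<open>C \<noteq> {}\<close> by blast
      obtain L \<epsilon> where L: "R = graph L \<epsilon>" "J \<subseteq> L" "\<forall>t\<in>J. \<epsilon> t = \<gamma> t" using CE[OF R] by blast
      have "(t, \<epsilon> t) \<in> R" unfolding L(1) graph_def by (rule imageI[OF subsetD[OF L(2) t]])
      then have "(t, \<gamma> t) \<in> \<Union>C" using R L(3) t by auto
      then show ?thesis by (rule \<delta>)
    qed
    ultimately show "\<Union>C \<in> E" using U \<open>J \<subseteq> K\<close> unfolding E_def by blast
  qed
  then obtain M where M: "M \<in> E" "\<And>X. X \<in> E \<Longrightarrow> M \<subseteq> X \<Longrightarrow> X = M" by blast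
  then obtain K \<delta> where K: "M = graph K \<delta>" "geodesic A g K \<delta>" "J \<subseteq> K" "\<And>t. t \<in> J \<Longrightarrow> \<delta> t = \<gamma> t"
    unfolding E_def by blast
  have "maximal_geodesic A g K \<delta>"
    unfolding maximal_geodesic_def
  proof (intro conjI K(2) notI; elim exE conjE)
    \<comment> \<open>The graph of a proper extension lies in \<open>E\<close> above
      \<open>M\<close>, so it equals \<open>M\<close>; projecting to the time axis gives the
      contradiction K' = K.\<close>
    fix K' \<delta>' assume *: "K \<subset> K'" "geodesic A g K' \<delta>'" "\<forall>t\<in>K. \<delta>' t = \<delta> t"
    have "J \<subseteq> K'" "\<forall>t\<in>J. \<delta>' t = \<gamma> t" using *(1,3) K(3,4) by auto
    then have "graph K' \<delta>' \<in> E" unfolding E_def using *(2) by blast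
    moreover have "M \<subseteq> graph K' \<delta>'" unfolding K(1) graph_def using * by auto
    ultimately have "fst ` graph K' \<delta>' = fst ` M" using M(2) by blast
    then show False using *(1) unfolding K(1) fst_graph by blast
  qed
  then show ?thesis using that K by blast
qed

context riemannian_manifold
begin

text \<open>The vector \<Gamma>(v, v) solves a linear system whose matrix consists of the metric
  coefficients and whose right-hand side is quadratic in \<open>v\<close> with smooth coefficients
  in the position.\<close>

lemma christoffel_locally_lipschitz_at:
  assumes c: "c \<in> A" and x0: "x0 \<in> chart_image c"
  shows "locally_lipschitz_at (\<lambda>p. christoffel A g c (fst p) (snd p) (snd p)) (x0, v0)"
proof -
  let ?S = "chart_image c \<times> (UNIV :: 'e set)"
  define M where "M p h = (\<Sum>i\<in>Basis. G c (fst p) h i *\<^sub>R i)" for p :: "'e \<times> 'e" and h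
  \<comment> \<open>For equal arguments the first two terms of the Koszul formula coincide, leaving
    \<open>D v w v - D v v w / 2\<close>, here expanded in the basis. Writing the subtraction with
    the scalar -1/2 fits the closure rules for sums and products.\<close>
  define b where "b p = (\<Sum>w\<in>Basis. (\<Sum>k\<in>Basis. \<Sum>i\<in>Basis. (snd p \<bullet> k) *\<^sub>R (snd p \<bullet> i) *\<^sub>R
      (D c (fst p) i w k + (-1/2) *\<^sub>R D c (fst p) i k w)) *\<^sub>R w)" for p :: "'e \<times> 'e"
  have S: "open ?S" "(x0, v0) \<in> ?S"
    using x0 open_chart_image[OF c] by (auto intro: open_Times)
  have fst: "locally_lipschitz_at (\<lambda>p. f (fst p)) (x0, v0)" if "smooth_on (chart_image c) f" for f :: "'e \<Rightarrow> real"
    by (rule locally_lipschitz_at_compose[OF locally_lipschitz_at_linear[OF bounded_linear_fst]])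
      (use smooth_on_locally_lipschitz_at[OF that open_chart_image[OF c]] x0 in simp)
  have snd: "locally_lipschitz_at (\<lambda>p. snd p \<bullet> i) (x0, v0)" for i
    by (intro locally_lipschitz_at_linear bounded_linear_inner_left_comp bounded_linear_snd)
  have Ml: "locally_lipschitz_at (\<lambda>p. M p h) (x0, v0)" for h
    unfolding M_def by (intro locally_lipschitz_at_sum locally_lipschitz_at_scaleR locally_lipschitz_at_const fst smooth_metric c)
  have DD: "locally_lipschitz_at (\<lambda>p. D c (fst p) i k w) (x0, v0)" for i k w
    by (rule fst) (unfold D_def, rule smooth_on_derivative[OF smooth_metric[OF c]])
  have bl: "locally_lipschitz_at b (x0, v0)"
    unfolding b_def by (intro locally_lipschitz_at_sum locally_lipschitz_at_scaleR locally_lipschitz_at_add locally_lipschitz_at_const snd DD)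
  have Mi: "M p h \<bullet> i = G c (fst p) h i" if "i \<in> Basis" for p h i
    unfolding M_def using that by (rule inner_sum_left_Basis)
  have lin: "linear (M p)" if "p \<in> ?S" for p
  proof -
    have B: "bilinear (G c (fst p))" using that metric_bilinear[OF c] by auto
    show ?thesis
      unfolding M_def
      by (rule linearI) (simp_all add: bilinear_ladd[OF B] bilinear_lmul[OF B] sum.distrib
          scaleR_add_left scaleR_sum_right)
  qed
  show ?thesis
  proof (rule locally_lipschitz_at_linear_solution[OF lin Ml _ bl S])
    show "inj (M (x0, v0))"
      unfolding linear_injective_0[OF lin[OF S(2)]]
    proof safe
      fix h assume "M (x0, v0) h = 0"
      then have "G c x0 h i = 0" if "i \<in> Basis" for i using Mi[OF that, of "(x0, v0)" h] by simp
      then have "G c x0 h h = 0"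
        using bilinear_expand[OF metric_bilinear[OF c x0], of h h]
          bilinear_expand[OF metric_bilinear[OF c x0]]
          linear_eq_stdbasis[of "G c x0 h" "\<lambda>_. 0"] metric_bilinear[OF c x0]
        unfolding bilinear_def by (metis linear_zero)
      then show "h = 0" using metric_pos[OF c x0, of h] by (cases "h = 0") auto
    qed
    fix p assume p: "p \<in> ?S"
    define x v where "x = fst p" and "v = snd p"
    have x: "x \<in> chart_image c" using p by (auto simp: x_def)
    have rep: "v = (\<Sum>i\<in>Basis. (v \<bullet> i) *\<^sub>R i)" by (simp add: euclidean_representation)
    have "G c x (christoffel A g c x v v) w =
        (\<Sum>k\<in>Basis. \<Sum>i\<in>Basis. (v \<bullet> k) * ((v \<bullet> i) * (D c x i w k + (-1/2) * D c x i k w)))" for w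
    proof -
      have l1: "linear (\<lambda>u. D c x u w k)" for k
        using D_bilinear[OF c x] by (simp add: bilinear_def)
      have "D c x v w v = (\<Sum>k\<in>Basis. (v \<bullet> k) * D c x v w k)"
        by (subst (2) rep) (simp add: linear_sum[OF D_linear[OF c x]] linear_scale[OF D_linear[OF c x]])
      also have "\<dots> = (\<Sum>k\<in>Basis. (v \<bullet> k) * (\<Sum>i\<in>Basis. (v \<bullet> i) * D c x i w k))"
      proof (rule sum.cong[OF refl])
        fix k
        have "D c x v w k = (\<Sum>i\<in>Basis. (v \<bullet> i) * D c x i w k)"
          by (subst rep) (simp add: linear_sum[OF l1] linear_scale[OF l1])
        then show "(v \<bullet> k) * D c x v w k = (v \<bullet> k) * (\<Sum>i\<in>Basis. (v \<bullet> i) * D c x i w k)" by simp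
      qed
      finally have 1: "D c x v w v = (\<Sum>k\<in>Basis. \<Sum>i\<in>Basis. (v \<bullet> k) * ((v \<bullet> i) * D c x i w k))"
        by (simp add: sum_distrib_left)
      have 2: "D c x v v w = (\<Sum>k\<in>Basis. \<Sum>i\<in>Basis. (v \<bullet> k) * ((v \<bullet> i) * D c x i k w))"
        unfolding bilinear_expand[OF D_bilinear[OF c x], of v v]
        by (simp add: mult.assoc D_sym[OF c x])
      have "G c x (christoffel A g c x v v) w = D c x v w v + (-1/2) * D c x v v w"
        unfolding metric_christoffel[OF c x] by simp
      also have "\<dots> = (\<Sum>k\<in>Basis. \<Sum>i\<in>Basis. (v \<bullet> k) * ((v \<bullet> i) * (D c x i w k + (-1/2) * D c x i k w)))"
        unfolding 1 2 sum_distrib_left sum.distrib[symmetric]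
        by (intro sum.cong refl) (simp add: algebra_simps)
      finally show ?thesis .
    qed
    then show "M p (christoffel A g c (fst p) (snd p) (snd p)) = b p"
      unfolding M_def b_def by (simp add: x_def v_def)
  qed
qed

text \<open>The geodesic equation becomes a first-order system for position and velocity. The
  coordinate curve and its velocity are returned as well, because they are differentiated
  later.\<close>

lemma local_geodesic:
  assumes c: "c \<in> A" and p: "p \<in> chart_dom c"
  obtains e \<gamma> x v where "e > 0" "geodesic A g {-e<..<e} \<gamma>" "x 0 = chart_map c p" "v 0 = v0"
    "\<And>t. \<bar>t\<bar> < e \<Longrightarrow> x t \<in> chart_image c \<and> \<gamma> t = chart_inv c (x t)"
    "\<And>t. \<bar>t\<bar> < e \<Longrightarrow> (x has_vector_derivative v t) (at t)"
    "\<And>t. \<bar>t\<bar> < e \<Longrightarrow> (v has_vector_derivative - christoffel A g c (x t) (v t) (v t)) (at t)"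
proof -
  let ?x0 = "chart_map c p"
  let ?F = "\<lambda>q. (snd q, (-1) *\<^sub>R christoffel A g c (fst q) (snd q) (snd q))"
  let ?S = "chart_image c \<times> (UNIV :: 'e set)"
  have "locally_lipschitz_at ?F (?x0, v0)"
    using c p by (intro locally_lipschitz_at_Pair locally_lipschitz_at_scaleR locally_lipschitz_at_const christoffel_locally_lipschitz_at
        locally_lipschitz_at_linear[OF bounded_linear_snd]) auto
  moreover have "open ?S" "(?x0, v0) \<in> ?S"
    using p open_chart_image[OF c] by (auto intro: open_Times)
  ultimately obtain e u where u: "e > 0" "u 0 = (?x0, v0)"
    "\<And>t. \<bar>t\<bar> < e \<Longrightarrow> u t \<in> ?S \<and> (u has_vector_derivative ?F (u t)) (at t)"
    using picard_local[of ?F "(?x0, v0)" ?S] by blast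
  define x v where "x t = fst (u t)" and "v t = snd (u t)" for t
  define \<gamma> where "\<gamma> t = chart_inv c (x t)" for t
  have x: "x t \<in> chart_image c" if "\<bar>t\<bar> < e" for t using u(3)[OF that] by (auto simp: x_def)
  have dx: "(x has_vector_derivative v t) (at t)" if "\<bar>t\<bar> < e" for t
    using bounded_linear.has_vector_derivative[OF bounded_linear_fst conjunct2[OF u(3)[OF that]]]
    by (simp add: x_def[abs_def] v_def)
  have dv: "(v has_vector_derivative - christoffel A g c (x t) (v t) (v t)) (at t)" if "\<bar>t\<bar> < e" for t
    using bounded_linear.has_vector_derivative[OF bounded_linear_snd conjunct2[OF u(3)[OF that]]]
    by (simp add: x_def v_def[abs_def])
  have "geodesic_at A g \<gamma> t" if t: "\<bar>t\<bar> < e" for t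
    unfolding geodesic_at_def
  proof (intro conjI bexI[of _ c] exI[of _ v])
    have "isCont x t" using dx[OF t] by (rule has_vector_derivative_continuous)
    then show "isCont \<gamma> t"
      unfolding \<gamma>_def using isCont_chart_inv[OF c x[OF t]] by (rule isCont_o2)
    have ev: "\<forall>\<^sub>F s in nhds t. \<bar>s\<bar> < e"
      using t eventually_nhds_in_open[of "{-e<..<e}" t] by (auto simp: abs_less_iff elim!: eventually_mono)
    show "\<forall>\<^sub>F s in nhds t. (chart_map c \<circ> \<gamma> has_vector_derivative v s) (at s)"
      using ev
    proof eventually_elim
      case (elim s)
      show ?case
        by (rule has_vector_derivative_transform_within_open[OF dx[OF elim], of "{-e<..<e}"])
          (use elim x c in \<open>auto simp: \<gamma>_def abs_less_iff\<close>)
    qed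
    show "(v has_vector_derivative - christoffel A g c (chart_map c (\<gamma> t)) (v t) (v t)) (at t)"
      using dv[OF t] c x[OF t] by (simp add: \<gamma>_def)
  qed (use c x[OF t] in \<open>auto simp: \<gamma>_def\<close>)
  then have "geodesic A g {-e<..<e} \<gamma>"
    using u(1) by (auto simp: geodesic_iff abs_less_iff)
  then show ?thesis
    using that[of e \<gamma> x v] u x dx dv by (simp add: \<gamma>_def x_def v_def)
qed

end

section \<open>The Killing field of a one-parameter group of isometries\<close>

locale isometric_flow = riemannian_manifold A g
  for A :: "('m::{t2_space, second_countable_topology}, 'e::euclidean_space) chart set"
    and g :: "('m, 'e) metric" +
  fixes \<phi> :: "real \<Rightarrow> 'm \<Rightarrow> 'm"
  assumes flow: "one_parameter_subgroup A g \<phi>"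
begin

definition generator :: "'m \<Rightarrow> ('m, 'e) tvec"
  where "generator p = (\<lambda>c. if c \<in> A \<and> p \<in> chart_dom c
    then vector_derivative (\<lambda>t. chart_map c (\<phi> t p)) (at 0) else 0)"

lemma isometry: "\<phi> t \<in> isometry_group A g"
  using flow by (simp add: one_parameter_subgroup_def)

lemma flow_add: "\<phi> (s + t) p = \<phi> s (\<phi> t p)"
  using flow by (simp add: one_parameter_subgroup_def)

text \<open>The map \<open>\<phi> 0\<close> is idempotent by the homomorphism law and injective as
  an isometry.\<close>

lemma flow_0 [simp]: "\<phi> 0 p = p"
proof -
  have "inj (\<phi> 0)" using isometry[of 0] by (simp add: isometry_group_def bij_is_inj)
  moreover have "\<phi> 0 (\<phi> 0 p) = \<phi> 0 p" using flow_add[of 0 0 p] by simp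
  ultimately show ?thesis by (simp add: inj_eq)
qed

lemma continuous_flow: "continuous_on UNIV (\<lambda>(t, p). \<phi> t p)"
  using flow by (simp add: one_parameter_subgroup_def smooth_map_def)

lemma continuous_orbit: "continuous_on UNIV (\<lambda>t. \<phi> t p)"
  using continuous_on_compose2[OF continuous_flow, of UNIV "\<lambda>t. (t, p)"]
  by (simp add: continuous_on_Pair)

section \<open>The flow read in charts\<close>

definition flow_dom :: "('m, 'e) chart \<Rightarrow> ('m, 'e) chart \<Rightarrow> (real \<times> 'e) set"
  where "flow_dom c d = {(t, x). x \<in> chart_image c \<and> \<phi> t (chart_inv c x) \<in> chart_dom d}"

definition flow_coord :: "('m, 'e) chart \<Rightarrow> ('m, 'e) chart \<Rightarrow> real \<times> 'e \<Rightarrow> 'e"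
  where "flow_coord c d = (\<lambda>(t, x). chart_map d (\<phi> t (chart_inv c x)))"

lemma open_flow_dom:
  assumes "c \<in> A" "d \<in> A" shows "open (flow_dom c d)"
proof -
  let ?f = "\<lambda>q. \<phi> (fst q) (chart_inv c (snd q))"
  have o: "open (UNIV \<times> chart_image c :: (real \<times> 'e) set)"
    using open_chart_image[OF assms(1)] by (intro open_Times) auto
  have "continuous_on (chart_image c) (chart_inv c)"
    using homeomorphism_chart[OF assms(1)] by (simp add: homeomorphism_def)
  then have "continuous_on (UNIV \<times> chart_image c) (\<lambda>q. chart_inv c (snd q))"
    by (rule continuous_on_compose2[OF _ continuous_on_snd[OF continuous_on_id]]) auto
  then have "continuous_on (UNIV \<times> chart_image c) (\<lambda>q. (fst q, chart_inv c (snd q)))"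
    by (intro continuous_on_Pair continuous_on_fst continuous_on_id)
  then have "continuous_on (UNIV \<times> chart_image c) ?f"
    using continuous_on_compose2[OF continuous_flow, of "UNIV \<times> chart_image c" "\<lambda>q. (fst q, chart_inv c (snd q))"]
    by simp
  then have "open (?f -` chart_dom d \<inter> (UNIV \<times> chart_image c))"
    using open_chart_dom[OF assms(2)] o by (simp add: continuous_on_open_vimage)
  moreover have "?f -` chart_dom d \<inter> (UNIV \<times> chart_image c) = flow_dom c d"
    by (auto simp: flow_dom_def)
  ultimately show ?thesis by simp
qed

lemma smooth_flow_coord:
  assumes c: "c \<in> A" and d: "d \<in> A" shows "smooth_on (flow_dom c d) (flow_coord c d)"
proof -
  let ?m = "\<lambda>(t, p). (t :: real, chart_map c p)"
  let ?C = "Chart (UNIV \<times> chart_dom c) ?m"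
  let ?F = "\<lambda>(t, p). \<phi> t p"
  have "?C \<in> time_atlas A" unfolding time_atlas_def using c by blast
  then have sm: "smooth_on (?m ` ((UNIV \<times> chart_dom c) \<inter> ?F -` chart_dom d)) (chart_map d \<circ> ?F \<circ> chart_inv ?C)"
    using flow d unfolding one_parameter_subgroup_def smooth_map_def by force
  have dom: "?m ` ((UNIV \<times> chart_dom c) \<inter> ?F -` chart_dom d) = flow_dom c d"
  proof (intro equalityI subsetI)
    fix q assume "q \<in> flow_dom c d"
    then obtain t x where q: "q = (t, x)" "x \<in> chart_image c" "\<phi> t (chart_inv c x) \<in> chart_dom d"
      by (auto simp: flow_dom_def)
    then show "q \<in> ?m ` ((UNIV \<times> chart_dom c) \<inter> ?F -` chart_dom d)"
      using c by (intro image_eqI[where x = "(t, chart_inv c x)"]) auto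
  qed (use c in \<open>auto simp: flow_dom_def\<close>)
  \<comment> \<open>The \<open>inv_into\<close> behind \<open>chart_inv\<close> is controlled only
    on the image of the product chart, so \<open>x\<close> is restricted to the image of
    \<open>c\<close>.\<close>
  have inv: "chart_inv ?C (t, x) = (t, chart_inv c x)" if "x \<in> chart_image c" for t x
  proof -
    have "inj_on (chart_map c) (chart_dom c)"
      using c by (metis chart_inv_map inj_on_inverseI)
    then have "inj_on ?m (UNIV \<times> chart_dom c)" by (auto simp: inj_on_def)
    then have "inv_into (UNIV \<times> chart_dom c) ?m (?m (t, chart_inv c x)) = (t, chart_inv c x)"
      using c that by (intro inv_into_f_f) auto
    then show ?thesis using c that by (simp add: chart_inv_def[of ?C])
  qed
  show ?thesis
  proof (rule smooth_on_cong[OF open_flow_dom[OF c d] _ sm[unfolded dom]])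
    fix q assume "q \<in> flow_dom c d"
    then show "(chart_map d \<circ> ?F \<circ> chart_inv ?C) q = flow_coord c d q"
      using inv by (cases q) (simp add: flow_dom_def flow_coord_def)
  qed
qed

lemma mem_flow_dom_0: "c \<in> A \<Longrightarrow> x \<in> chart_image c \<Longrightarrow> (0, x) \<in> flow_dom c c"
  by (simp add: flow_dom_def)

lemma flow_coord_has_derivative:
  assumes "c \<in> A" "d \<in> A" "(t, x) \<in> flow_dom c d"
  shows "(flow_coord c d has_derivative frechet_derivative (flow_coord c d) (at (t, x))) (at (t, x))"
  by (rule smooth_on_has_derivative[OF smooth_flow_coord]) (use assms in auto)

lemma flow_has_vector_derivative_0:
  assumes c: "c \<in> A" and p: "p \<in> chart_dom c"
  shows "((\<lambda>t. chart_map c (\<phi> t p)) has_vector_derivative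
    frechet_derivative (flow_coord c c) (at (0, chart_map c p)) (1, 0)) (at 0)"
proof -
  have "(\<lambda>t. flow_coord c c (t, chart_map c p)) = (\<lambda>t. chart_map c (\<phi> t p))"
    using c p by (simp add: flow_coord_def)
  then show ?thesis
    using has_vector_derivative_slice[OF flow_coord_has_derivative[OF c c mem_flow_dom_0[OF c]], of "chart_map c p"] p
    by simp
qed

lemma generator_coord:
  assumes "c \<in> A" "p \<in> chart_dom c"
  shows "generator p c = frechet_derivative (flow_coord c c) (at (0, chart_map c p)) (1, 0)"
  using assms vector_derivative_at[OF flow_has_vector_derivative_0[OF assms]] by (simp add: generator_def)

lemma field_coord_generator:
  assumes "c \<in> A" "x \<in> chart_image c"
  shows "field_coord generator c x = frechet_derivative (flow_coord c c) (at (0, x)) (1, 0)"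
  unfolding field_coord_def using assms by (simp add: generator_coord)

text \<open>By the homomorphism law the orbit near time \<open>t\<close> is the orbit of
  \<open>\<phi> t p\<close> near time 0.\<close>

lemma orbit_has_vector_derivative:
  assumes c: "c \<in> A" and p: "\<phi> t p \<in> chart_dom c"
  shows "((\<lambda>s. chart_map c (\<phi> s p)) has_vector_derivative generator (\<phi> t p) c) (at t)"
proof -
  have "((\<lambda>s. chart_map c (\<phi> s (\<phi> t p))) has_vector_derivative generator (\<phi> t p) c) (at (t - t))"
    using flow_has_vector_derivative_0[OF assms] generator_coord[OF assms] by simp
  moreover have "((\<lambda>s. s - t) has_vector_derivative 1) (at t)"
    by (auto intro!: derivative_eq_intros)
  ultimately have "((\<lambda>s. chart_map c (\<phi> (s - t) (\<phi> t p))) has_vector_derivative generator (\<phi> t p) c) (at t)"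
    using vector_diff_chain_at[where f = "\<lambda>s. s - t" and f' = 1] by (fastforce simp: o_def)
  moreover have "\<phi> (s - t) (\<phi> t p) = \<phi> s p" for s using flow_add[of "s - t" t p] by simp
  ultimately show ?thesis by simp
qed

lemma eventually_orbit_mem:
  assumes "open U" "\<phi> t p \<in> U"
  obtains T where "open T" "t \<in> T" "\<And>s. s \<in> T \<Longrightarrow> \<phi> s p \<in> U"
proof -
  have "open ((\<lambda>s. \<phi> s p) -` U)"
    using continuous_orbit assms(1) by (metis open_vimage)
  then show ?thesis using that[of "(\<lambda>s. \<phi> s p) -` U"] assms(2) by auto
qed

text \<open>The transformation rule comes from differentiating one orbit in two charts. Smoothness
  holds because the generator is the time derivative of the smooth coordinate flow, sliced at time
  0.\<close>

lemma generator_in_vector_fields: "generator \<in> vector_fields A"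
  unfolding vector_fields_def mem_Collect_eq
proof (intro conjI allI ballI)
  fix p
  have tr: "generator p d = frechet_derivative (chart_map d \<circ> chart_inv c) (at (chart_map c p)) (generator p c)"
    if cd: "c \<in> A" "d \<in> A" "p \<in> chart_dom c" "p \<in> chart_dom d" for c d
  proof -
    let ?t = "frechet_derivative (chart_map d \<circ> chart_inv c) (at (chart_map c p))"
    have 1: "((\<lambda>t. chart_map c (\<phi> t p)) has_derivative (\<lambda>h. h *\<^sub>R generator p c)) (at 0)"
      using orbit_has_vector_derivative[of c 0 p] cd by (simp add: has_vector_derivative_def)
    have 2: "(chart_map d \<circ> chart_inv c has_derivative ?t) (at (chart_map c (\<phi> 0 p)))"
      using transition_has_derivative[OF cd] by simp
    have 3: "((\<lambda>t. (chart_map d \<circ> chart_inv c) (chart_map c (\<phi> t p))) has_derivative (\<lambda>h. ?t (h *\<^sub>R generator p c))) (at 0)"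
      by (rule has_derivative_compose[where f = "\<lambda>t. chart_map c (\<phi> t p)", OF 1 2])
    obtain T where T: "open T" "0 \<in> T" "\<And>s. s \<in> T \<Longrightarrow> \<phi> s p \<in> chart_dom c"
      using eventually_orbit_mem[OF open_chart_dom[OF cd(1)], of 0 p] cd by auto
    have 4: "((\<lambda>t. chart_map d (\<phi> t p)) has_derivative (\<lambda>h. ?t (h *\<^sub>R generator p c))) (at 0)"
      by (rule has_derivative_transform_within_open[OF 3 T(1,2)]) (use T(3) cd in auto)
    have "((\<lambda>t. chart_map d (\<phi> t p)) has_derivative (\<lambda>h. h *\<^sub>R generator p d)) (at 0)"
      using orbit_has_vector_derivative[of d 0 p] cd by (simp add: has_vector_derivative_def)
    from fun_cong[OF has_derivative_unique[OF 4 this], of 1] show ?thesis by simp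
  qed
  show "generator p \<in> tangent_space A p"
    unfolding tangent_space_def mem_Collect_eq
  proof (intro conjI allI ballI impI)
    fix c d assume "c \<in> A" "d \<in> A" "p \<in> chart_dom c \<inter> chart_dom d"
    then show "generator p d = frechet_derivative (chart_map d \<circ> chart_inv c) (at (chart_map c p)) (generator p c)"
      by (intro tr) auto
  qed (auto simp: generator_def)
next
  fix c assume c: "c \<in> A"
  have "smooth_on (chart_image c) (\<lambda>x. frechet_derivative (flow_coord c c) (at (0, x)) (1, 0))"
    by (rule smooth_on_slice[OF smooth_on_derivative[OF smooth_flow_coord[OF c c]]
          open_chart_image[OF c] mem_flow_dom_0[OF c]])
  then show "smooth_on (chart_image c) (field_coord generator c)"
    by (rule smooth_on_cong[OF open_chart_image[OF c], rotated]) (simp add: field_coord_generator c)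
qed

text \<open>The chart \<open>c0\<close> hidden in \<open>differential\<close> is traded for
  \<open>c\<close> on the source side by \<open>transition_compose\<close>; on the target side the
  chain rule passes from \<open>c\<close> to \<open>d\<close>.\<close>

lemma differential_flow:
  assumes c: "c \<in> A" and x: "(t, x) \<in> flow_dom c c"
  shows "differential A (\<phi> t) (chart_inv c x) (coord_vector A c (chart_inv c x) u) =
    coord_vector A c (\<phi> t (chart_inv c x)) (frechet_derivative (flow_coord c c) (at (t, x)) (0, u))"
proof (rule ext)
  fix d
  let ?p = "chart_inv c x"
  define c0 where "c0 = (SOME c. c \<in> A \<and> ?p \<in> chart_dom c)"
  have xc: "x \<in> chart_image c" "\<phi> t ?p \<in> chart_dom c" using x by (auto simp: flow_dom_def)
  then have p: "?p \<in> chart_dom c" using c by simp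
  have "\<exists>c. c \<in> A \<and> ?p \<in> chart_dom c" using c p by blast
  then have c0: "c0 \<in> A" "?p \<in> chart_dom c0"
    unfolding c0_def by (metis (mono_tags, lifting) someI_ex)+
  show "differential A (\<phi> t) ?p (coord_vector A c ?p u) d =
    coord_vector A c (\<phi> t ?p) (frechet_derivative (flow_coord c c) (at (t, x)) (0, u)) d"
  proof (cases "d \<in> A \<and> \<phi> t ?p \<in> chart_dom d")
    case False
    then show ?thesis by (auto simp: differential_def coord_vector_def Let_def)
  next
    case True
    then have d: "d \<in> A" "\<phi> t ?p \<in> chart_dom d" by auto
    let ?f = "\<lambda>b. frechet_derivative (flow_coord b d) (at (t, chart_map b ?p))"
    have slice: "(chart_map d \<circ> \<phi> t \<circ> chart_inv b has_derivative (\<lambda>v. ?f b (0, v))) (at (chart_map b ?p))"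
      if b: "b \<in> A" "?p \<in> chart_dom b" for b
    proof -
      have "(t, chart_map b ?p) \<in> flow_dom b d" using b d by (simp add: flow_dom_def)
      from has_derivative_slice[OF flow_coord_has_derivative[OF b(1) d(1) this]]
      show ?thesis by (simp add: flow_coord_def o_def)
    qed
    have "frechet_derivative (chart_map d \<circ> \<phi> t \<circ> chart_inv c0) (at (chart_map c0 ?p))
        (frechet_derivative (chart_map c0 \<circ> chart_inv c) (at (chart_map c ?p)) u) =
      frechet_derivative (chart_map d \<circ> \<phi> t \<circ> chart_inv c) (at (chart_map c ?p)) u"
      using frechet_derivative_at[OF transition_compose[OF c c0(1) p c0(2) slice[OF c0]]]
        frechet_derivative_at[OF slice[OF c0]] by metis
    then have L: "differential A (\<phi> t) ?p (coord_vector A c ?p u) d =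
      frechet_derivative (chart_map d \<circ> \<phi> t \<circ> chart_inv c) (at x) u"
      unfolding differential_def Let_def c0_def[symmetric] coord_vector_def
      using c0 d c xc by simp
    let ?q = "\<phi> t ?p"
    let ?k = "frechet_derivative (chart_map d \<circ> chart_inv c) (at (chart_map c ?q))"
    have f: "((\<lambda>y. flow_coord c c (t, y)) has_derivative
        (\<lambda>v. frechet_derivative (flow_coord c c) (at (t, x)) (0, v))) (at x)"
      by (rule has_derivative_slice[OF flow_coord_has_derivative[OF c c x]])
    have k: "(chart_map d \<circ> chart_inv c has_derivative ?k) (at (flow_coord c c (t, x)))"
      using transition_has_derivative[OF c d(1) xc(2) d(2)] by (simp add: flow_coord_def)
    have 1: "((\<lambda>y. (chart_map d \<circ> chart_inv c) (flow_coord c c (t, y))) has_derivative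
        (\<lambda>v. ?k (frechet_derivative (flow_coord c c) (at (t, x)) (0, v)))) (at x)"
      by (rule has_derivative_compose[where f = "\<lambda>y. flow_coord c c (t, y)", OF f k])
    have "(chart_map d \<circ> \<phi> t \<circ> chart_inv c has_derivative
        (\<lambda>v. ?k (frechet_derivative (flow_coord c c) (at (t, x)) (0, v)))) (at x)"
    proof (rule has_derivative_transform_within_open[OF 1])
      have "open (Pair t -` flow_dom c c)"
        by (intro open_vimage open_flow_dom c continuous_intros)
      then show "open {y. (t, y) \<in> flow_dom c c}" by (simp add: vimage_def)
      show "x \<in> {y. (t, y) \<in> flow_dom c c}" using x by simp
    qed (use c in \<open>auto simp: flow_dom_def flow_coord_def\<close>)
    from fun_cong[OF frechet_derivative_at[OF this], of u]
    have "frechet_derivative (chart_map d \<circ> \<phi> t \<circ> chart_inv c) (at x) u =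
      coord_vector A c ?q (frechet_derivative (flow_coord c c) (at (t, x)) (0, u)) d"
      unfolding coord_vector_def if_P[OF True] by (rule sym)
    with L show ?thesis by (rule trans)
  qed
qed

lemma flow_preserves_metric_coord:
  assumes c: "c \<in> A" and x: "(t, x) \<in> flow_dom c c"
  shows "G c (flow_coord c c (t, x)) (frechet_derivative (flow_coord c c) (at (t, x)) (0, u))
    (frechet_derivative (flow_coord c c) (at (t, x)) (0, w)) = G c x u w"
proof -
  let ?p = "chart_inv c x"
  have xc: "x \<in> chart_image c" "\<phi> t ?p \<in> chart_dom c" using x by (auto simp: flow_dom_def)
  have "g (\<phi> t ?p) (differential A (\<phi> t) ?p v) (differential A (\<phi> t) ?p v') = g ?p v v'"
    if "v \<in> tangent_space A ?p" "v' \<in> tangent_space A ?p" for v v'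
    using isometry[of t] that by (simp add: isometry_group_def)
  from this[of "coord_vector A c ?p u" "coord_vector A c ?p w"]
  show ?thesis
    using c xc unfolding metric_coord_def
    by (simp add: coord_vector_in_tangent_space differential_flow[OF c x] flow_coord_def)
qed

text \<open>The pulled-back metric is independent of time; its time derivative at 0 is the Killing
  equation.\<close>

lemma generator_killing: "generator \<in> killing_fields A g"
  unfolding killing_fields_def mem_Collect_eq
proof (intro conjI generator_in_vector_fields ballI allI)
  fix c x u w assume c: "c \<in> A" and x: "x \<in> chart_image c"
  let ?\<Phi> = "flow_coord c c"
  let ?D = "\<lambda>q. frechet_derivative ?\<Phi> (at q)"
  let ?Z = "field_coord generator c"
  have x0: "(0, x) \<in> flow_dom c c" using mem_flow_dom_0[OF c x] .
  have \<Phi>0: "?\<Phi> (0, y) = y" if "y \<in> chart_image c" for y using c that by (simp add: flow_coord_def)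
  have D0: "?D (0, x) (0, v) = v" for v
  proof -
    have "((\<lambda>y. ?\<Phi> (0, y)) has_derivative (\<lambda>v. v)) (at x)"
      by (rule has_derivative_transform_within_open[OF has_derivative_ident open_chart_image[OF c] x])
        (simp add: \<Phi>0)
    from has_derivative_unique[OF has_derivative_slice[OF flow_coord_has_derivative[OF c c x0]] this]
    show ?thesis by metis
  qed
  have p: "((\<lambda>t. ?\<Phi> (t, x)) has_derivative (\<lambda>h. h *\<^sub>R ?Z x)) (at 0)"
    using has_vector_derivative_slice[OF flow_coord_has_derivative[OF c c x0]]
    by (simp add: has_vector_derivative_def field_coord_generator[OF c x])
  \<comment> \<open>The time derivative of the space derivative of the flow is the space derivative
    of its time derivative, that is, of the generator.\<close>
  have q: "((\<lambda>t. ?D (t, x) (0, v)) has_derivative (\<lambda>h. h *\<^sub>R frechet_derivative ?Z (at x) v)) (at 0)" for v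
  proof -
    note s = smooth_on_derivative[OF smooth_flow_coord[OF c c]]
    have 1: "((\<lambda>t. ?D (t, x) (0, v)) has_vector_derivative
        frechet_derivative (\<lambda>q. ?D q (0, v)) (at (0, x)) (1, 0)) (at 0)"
      by (rule has_vector_derivative_slice[where f = "\<lambda>q. ?D q (0, v)", OF smooth_on_has_derivative[OF s x0]])
    have 2: "((\<lambda>y. ?D (0, y) (1, 0)) has_derivative
        (\<lambda>v. frechet_derivative (\<lambda>q. ?D q (1, 0)) (at (0, x)) (0, v))) (at x)"
      by (rule has_derivative_slice[where f = "\<lambda>q. ?D q (1, 0)", OF smooth_on_has_derivative[OF s x0]])
    have "(?Z has_derivative (\<lambda>v. frechet_derivative (\<lambda>q. ?D q (1, 0)) (at (0, x)) (0, v))) (at x)"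
      by (rule has_derivative_transform_within_open[OF 2 open_chart_image[OF c] x])
        (simp add: field_coord_generator[OF c])
    from fun_cong[OF frechet_derivative_at[OF this], of v]
    have "frechet_derivative ?Z (at x) v = frechet_derivative (\<lambda>q. ?D q (0, v)) (at (0, x)) (1, 0)"
      using smooth_on_mixed_derivatives_eq[OF smooth_flow_coord[OF c c] open_flow_dom[OF c c] x0, of "(1, 0)" "(0, v)"]
      by simp
    then show ?thesis using 1 by (simp add: has_vector_derivative_def)
  qed
  have "((\<lambda>t. G c (?\<Phi> (t, x)) (?D (t, x) (0, u)) (?D (t, x) (0, w))) has_derivative
      (\<lambda>h. D c x (?D (0, x) (0, u)) (?D (0, x) (0, w)) (h *\<^sub>R ?Z x)
        + G c (?\<Phi> (0, x)) (h *\<^sub>R frechet_derivative ?Z (at x) u) (?D (0, x) (0, w))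
        + G c (?\<Phi> (0, x)) (?D (0, x) (0, u)) (h *\<^sub>R frechet_derivative ?Z (at x) w))) (at 0)"
    by (rule has_derivative_bilinear_form[OF open_chart_image[OF c] _ metric_bilinear[OF c] _ p q q])
      (use x \<Phi>0 metric_has_derivative[OF c x] in auto)
  moreover have "((\<lambda>t. G c (?\<Phi> (t, x)) (?D (t, x) (0, u)) (?D (t, x) (0, w))) has_derivative (\<lambda>h. 0)) (at 0)"
  proof (rule has_derivative_transform_within_open[OF has_derivative_const])
    have "open ((\<lambda>t. (t, x)) -` flow_dom c c)"
      by (intro open_vimage open_flow_dom c continuous_intros)
    then show "open {t. (t, x) \<in> flow_dom c c}" by (simp add: vimage_def)
    show "0 \<in> {t. (t, x) \<in> flow_dom c c}" using x0 by simp
    show "G c x u w = G c (?\<Phi> (t, x)) (?D (t, x) (0, u)) (?D (t, x) (0, w))" if "t \<in> {t. (t, x) \<in> flow_dom c c}" for t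
      using flow_preserves_metric_coord[OF c] that by simp
  qed
  ultimately have "(\<lambda>h. D c x (?D (0, x) (0, u)) (?D (0, x) (0, w)) (h *\<^sub>R ?Z x)
        + G c (?\<Phi> (0, x)) (h *\<^sub>R frechet_derivative ?Z (at x) u) (?D (0, x) (0, w))
        + G c (?\<Phi> (0, x)) (?D (0, x) (0, u)) (h *\<^sub>R frechet_derivative ?Z (at x) w)) = (\<lambda>h. 0)"
    by (rule has_derivative_unique)
  from fun_cong[OF this, of 1]
  show "frechet_derivative (\<lambda>y. G c y u w) (at x) (?Z x) + G c x (frechet_derivative ?Z (at x) u) w
     + G c x u (frechet_derivative ?Z (at x) w) = 0"
    by (simp add: D0 \<Phi>0 x D_def)
qed

text \<open>The differential of \<open>\<phi> t\<close> carries the generator at \<open>p\<close> to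
  the generator at \<open>\<phi> t p\<close>, so the generator vanishes along the whole orbit, and
  the orbit is locally constant in time.\<close>

lemma fixed_of_generator_zero:
  assumes c: "c \<in> A" and p: "p \<in> chart_dom c" and Z: "generator p c = 0"
  shows "\<phi> t p = p"
proof -
  have zero: "generator (\<phi> t p) d = 0" if d: "d \<in> A" "\<phi> t p \<in> chart_dom d" for t d
  proof -
    have dom: "(t, chart_map c p) \<in> flow_dom c d" using c p d by (simp add: flow_dom_def)
    have 1: "((\<lambda>s. chart_map c (\<phi> s p)) has_derivative (\<lambda>h. 0)) (at 0)"
      using orbit_has_vector_derivative[of c 0 p] c p Z by (simp add: has_vector_derivative_def)
    have 2: "((\<lambda>y. flow_coord c d (t, y)) has_derivative
        (\<lambda>v. frechet_derivative (flow_coord c d) (at (t, chart_map c p)) (0, v))) (at (chart_map c (\<phi> 0 p)))"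
      using has_derivative_slice[OF flow_coord_has_derivative[OF c d(1) dom]] by simp
    have 3: "((\<lambda>s. flow_coord c d (t, chart_map c (\<phi> s p))) has_derivative
        (\<lambda>h. frechet_derivative (flow_coord c d) (at (t, chart_map c p)) (0, 0))) (at 0)"
      by (rule has_derivative_compose[where f = "\<lambda>s. chart_map c (\<phi> s p)"
            and g = "\<lambda>y. flow_coord c d (t, y)", OF 1 2])
    obtain T where T: "open T" "0 \<in> T" "\<And>s. s \<in> T \<Longrightarrow> \<phi> s p \<in> chart_dom c"
      using eventually_orbit_mem[OF open_chart_dom[OF c], of 0 p] p by auto
    \<comment> \<open>Flow maps commute, so applying \<open>\<phi> t\<close> to the orbit of
      \<open>p\<close> gives the orbit of \<open>\<phi> t p\<close>.\<close>
    have 4: "((\<lambda>s. chart_map d (\<phi> s (\<phi> t p))) has_derivative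
        (\<lambda>h. frechet_derivative (flow_coord c d) (at (t, chart_map c p)) (0, 0))) (at 0)"
    proof (rule has_derivative_transform_within_open[OF 3 T(1,2)])
      fix s assume "s \<in> T"
      then show "flow_coord c d (t, chart_map c (\<phi> s p)) = chart_map d (\<phi> s (\<phi> t p))"
        using c T(3) by (simp add: flow_coord_def add.commute flip: flow_add)
    qed
    have "((\<lambda>s. chart_map d (\<phi> s (\<phi> t p))) has_derivative (\<lambda>h. h *\<^sub>R generator (\<phi> t p) d)) (at 0)"
      using orbit_has_vector_derivative[of d 0 "\<phi> t p"] d by (simp add: has_vector_derivative_def)
    from fun_cong[OF has_derivative_unique[OF 4 this], of 0] fun_cong[OF has_derivative_unique[OF 4 this], of 1]
    show ?thesis by simp
  qed
  have "\<phi> t p = \<phi> 0 p"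
  proof (rule connected_local_const[OF connected_UNIV UNIV_I UNIV_I], rule ballI)
    fix t :: real
    obtain d where d: "d \<in> A" "\<phi> t p \<in> chart_dom d" using chart_at .
    obtain T where T: "open T" "t \<in> T" "\<And>s. s \<in> T \<Longrightarrow> \<phi> s p \<in> chart_dom d"
      using eventually_orbit_mem[OF open_chart_dom[OF d(1)] d(2)] by blast
    obtain e where e: "e > 0" "ball t e \<subseteq> T" using T open_contains_ball by blast
    have "\<phi> t p = \<phi> s p" if s: "s \<in> ball t e" for s
    proof -
      have "chart_map d (\<phi> s p) = chart_map d (\<phi> t p)"
      proof (rule has_derivative_zero_unique[OF convex_ball _ s])
        fix r assume "r \<in> ball t e"
        then have r: "\<phi> r p \<in> chart_dom d" using subsetD[OF e(2)] T(3) by blast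
        show "((\<lambda>s. chart_map d (\<phi> s p)) has_derivative (\<lambda>h. 0)) (at r within ball t e)"
          using orbit_has_vector_derivative[OF d(1) r] zero[OF d(1) r]
          by (auto intro: has_derivative_at_withinI simp: has_vector_derivative_def)
      qed (use e in auto)
      then show ?thesis
        using chart_inv_map d T(3) e s by (metis subsetD)
    qed
    then show "\<forall>\<^sub>F s in at t. \<phi> t p = \<phi> s p"
      using e(1) eventually_at_ball[of e t UNIV] by (auto elim: eventually_mono)
  qed
  then show ?thesis by simp
qed

end

section \<open>Geodesics that are orbits\<close>

text \<open>Sets of a countable basis that isolate different points are different.\<close>

lemma countable_isolated_points:
  fixes Q :: "'a::second_countable_topology set"
  assumes "\<And>q. q \<in> Q \<Longrightarrow> \<exists>T. open T \<and> T \<inter> Q = {q}"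
  shows "countable Q"
proof -
  obtain \<B> :: "'a set set" where B: "countable \<B>" "topological_basis \<B>"
    using ex_countable_basis by blast
  have "\<exists>b. b \<in> \<B> \<and> b \<inter> Q = {q}" if q: "q \<in> Q" for q
  proof -
    obtain T where T: "open T" "T \<inter> Q = {q}" using assms[OF q] by blast
    then have "q \<in> T" by blast
    then obtain b where "b \<in> \<B>" "q \<in> b" "b \<subseteq> T" using topological_basisE[OF B(2) T(1)] by blast
    then have "b \<inter> Q = {q}" using T(2) q by blast
    then show ?thesis using \<open>b \<in> \<B>\<close> by blast
  qed
  then obtain f where f: "\<And>q. q \<in> Q \<Longrightarrow> f q \<in> \<B> \<and> f q \<inter> Q = {q}" by metis
  have "inj_on f Q"
  proof (rule inj_onI)
    fix q r assume "q \<in> Q" "r \<in> Q" "f q = f r"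
    then have "{q} = {r}" using f[of q] f[of r] by metis
    then show "q = r" by simp
  qed
  moreover have "f ` Q \<subseteq> \<B>" using f by blast
  ultimately show ?thesis
    using countable_image_inj_on[OF countable_subset[OF _ B(1)]] by auto
qed

text \<open>The derivative stretches by at least \<open>B\<close>, while the linearisation error
  stays below half of that.\<close>

lemma isolated_zero_of_injective_derivative:
  fixes f :: "'a::euclidean_space \<Rightarrow> 'b::euclidean_space"
  assumes f: "(f has_derivative f') (at q)" and inj: "inj f'" and "f q = 0"
  obtains T where "open T" "q \<in> T" "\<And>y. y \<in> T \<Longrightarrow> f y = 0 \<Longrightarrow> y = q"
proof -
  obtain B where B: "B > 0" "\<And>h. B * norm h \<le> norm (f' h)"
    using linear_inj_bounded_below_pos[OF has_derivative_linear[OF f] inj] by blast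
  obtain d where d: "d > 0" "\<And>y. norm (y - q) < d \<Longrightarrow> norm (f y - f q - f' (y - q)) \<le> B / 2 * norm (y - q)"
    using f B(1) unfolding has_derivative_at_alt by (metis half_gt_zero)
  show ?thesis
  proof (rule that[of "ball q d"])
    fix y assume y: "y \<in> ball q d" "f y = 0"
    have "B * norm (y - q) \<le> norm (f' (y - q))" by (rule B(2))
    also have "\<dots> \<le> B / 2 * norm (y - q)"
      using d(2)[of y] y assms(3) by (simp add: dist_norm norm_minus_commute)
    finally have "B / 2 * norm (y - q) \<le> 0" by (simp add: field_simps)
    then show "y = q" using B(1) by (simp add: mult_le_0_iff)
  qed (use d in auto)
qed

text \<open>The equality case of Cauchy-Schwarz: the component of \<open>u\<close> orthogonal to
  \<open>w\<close> has length 0.\<close>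

lemma parallel_of_gram_zero:
  fixes u w :: "'a::real_inner"
  assumes "w \<noteq> 0" "(u \<bullet> u) * (w \<bullet> w) = (u \<bullet> w)\<^sup>2"
  shows "u = ((u \<bullet> w) / (w \<bullet> w)) *\<^sub>R w"
proof -
  let ?r = "(u \<bullet> w) / (w \<bullet> w)"
  have w: "w \<bullet> w \<noteq> 0" using assms(1) by simp
  have "(u - ?r *\<^sub>R w) \<bullet> (u - ?r *\<^sub>R w) = u \<bullet> u - 2 * ?r * (u \<bullet> w) + ?r * ?r * (w \<bullet> w)"
    by (simp add: inner_diff_left inner_diff_right inner_commute algebra_simps)
  also have "\<dots> = u \<bullet> u - (u \<bullet> w)\<^sup>2 / (w \<bullet> w)"
    using w by (simp add: power2_eq_square)
  also have "\<dots> = 0" using w assms(2) by (metis diff_self nonzero_mult_div_cancel_right)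
  finally show ?thesis by (simp add: inner_eq_zero_iff)
qed

context isometric_flow
begin

text \<open>
  Only the inclusion of sets of points is known. If the velocities of the geodesic and of the orbit
  were independent on an interval of times \<open>s\<close>, then the pairs \<open>(s, t)\<close> at which the two curves meet
  would be isolated, hence countable in number, although every \<open>s\<close> in the interval occurs.
\<close>

lemma geodesic_velocity_parallel_to_generator:
  assumes c: "c \<in> A"
    and x: "\<And>s. \<bar>s\<bar> < e \<Longrightarrow> x s \<in> chart_image c"
    and dx: "\<And>s. \<bar>s\<bar> < e \<Longrightarrow> (x has_vector_derivative v s) (at s)"
    and orbit: "\<And>s. \<bar>s\<bar> < e \<Longrightarrow> \<exists>t. chart_inv c (x s) = \<phi> t p"
    and cont: "\<And>s. \<bar>s\<bar> < e \<Longrightarrow> isCont v s" and s0: "\<bar>s0\<bar> < e"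
  shows "(v s0 \<bullet> v s0) * (field_coord generator c (x s0) \<bullet> field_coord generator c (x s0))
    = (v s0 \<bullet> field_coord generator c (x s0))\<^sup>2"
proof (rule ccontr)
  let ?Z = "field_coord generator c"
  \<comment> \<open>The Gram determinant for the Euclidean inner product of the coordinate space,
    used only to test linear independence of velocity and generator.\<close>
  define gr where "gr s = (v s \<bullet> v s) * (?Z (x s) \<bullet> ?Z (x s)) - (v s \<bullet> ?Z (x s))\<^sup>2" for s
  assume "\<not> ?thesis"
  then have gr0: "gr s0 \<noteq> 0" by (simp add: gr_def)
  have Zc: "continuous_on (chart_image c) ?Z"
    using generator_in_vector_fields c smooth_on_continuous unfolding vector_fields_def by blast
  have "isCont (\<lambda>s. ?Z (x s)) s0"
  proof (rule isCont_o2[where f = x])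
    show "isCont x s0" using dx[OF s0] by (rule has_vector_derivative_continuous)
    show "isCont ?Z (x s0)"
      using Zc open_chart_image[OF c] x[OF s0] by (simp add: continuous_on_eq_continuous_at)
  qed
  then have "isCont gr s0"
    unfolding gr_def using cont[OF s0] by (intro continuous_intros)
  then have "\<forall>\<^sub>F s in nhds s0. gr s \<noteq> 0"
    unfolding isCont_def tendsto_at_iff_tendsto_nhds using gr0 by (rule tendsto_imp_eventually_ne)
  moreover have "\<forall>\<^sub>F s in nhds s0. s \<in> {-e<..<e}"
    using s0 by (intro eventually_nhds_in_open) auto
  ultimately have "\<forall>\<^sub>F s in nhds s0. gr s \<noteq> 0 \<and> \<bar>s\<bar> < e"
    by eventually_elim auto
  then obtain d where d: "d > 0" "\<And>s. dist s s0 < d \<Longrightarrow> gr s \<noteq> 0 \<and> \<bar>s\<bar> < e"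
    unfolding eventually_nhds_metric by blast
  define Q where "Q = {(s, t). dist s s0 < d \<and> chart_inv c (x s) = \<phi> t p}"
  have "countable Q"
  proof (rule countable_isolated_points)
    fix q assume "q \<in> Q"
    then obtain s t where q: "q = (s, t)" "dist s s0 < d" "chart_inv c (x s) = \<phi> t p"
      by (auto simp: Q_def)
    have s: "gr s \<noteq> 0" "\<bar>s\<bar> < e" using d(2)[OF q(2)] by auto
    have pt: "\<phi> t p \<in> chart_dom c" using chart_inv_dom[OF c x[OF s(2)]] q(3) by simp
    have gen: "generator (\<phi> t p) c = ?Z (x s)" by (simp add: field_coord_def q(3))
    \<comment> \<open>Every pair in \<open>Q\<close> is a zero of \<open>f\<close>. Its derivative
      combines the two independent vectors \<open>v s\<close> and \<open>?Z (x s)\<close>, hence is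
      injective.\<close>
    define f where "f r = x (fst r) - chart_map c (\<phi> (snd r) p)" for r
    define f' where "f' h = fst h *\<^sub>R v s - snd h *\<^sub>R ?Z (x s)" for h :: "real \<times> real"
    have 1: "((\<lambda>r. x (fst r)) has_derivative (\<lambda>h. fst h *\<^sub>R v s)) (at q)"
      by (rule has_derivative_compose[where g = x, OF has_derivative_fst[OF has_derivative_ident]])
        (use dx[OF s(2)] in \<open>simp add: has_vector_derivative_def q(1)\<close>)
    have 2: "((\<lambda>r. chart_map c (\<phi> (snd r) p)) has_derivative (\<lambda>h. snd h *\<^sub>R ?Z (x s))) (at q)"
      by (rule has_derivative_compose[where g = "\<lambda>t. chart_map c (\<phi> t p)", OF has_derivative_snd[OF has_derivative_ident]])
        (use orbit_has_vector_derivative[OF c pt] in \<open>simp add: has_vector_derivative_def q(1) gen\<close>)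
    have df: "(f has_derivative f') (at q)"
      unfolding f_def[abs_def] f'_def[abs_def] by (rule has_derivative_diff[OF 1 2])
    have "inj f'"
      unfolding linear_injective_0[OF has_derivative_linear[OF df]]
    proof (intro allI impI)
      fix r assume "f' r = 0"
      then have eq: "fst r *\<^sub>R v s = snd r *\<^sub>R ?Z (x s)" by (simp add: f'_def)
      have Z0: "?Z (x s) \<noteq> 0" using s(1) by (auto simp: gr_def)
      have "fst r = 0"
      proof (rule ccontr)
        assume "fst r \<noteq> 0"
        then have "v s = (snd r / fst r) *\<^sub>R ?Z (x s)"
          using eq by (metis divideR_right divide_inverse_commute scaleR_scaleR)
        then have "gr s = 0" by (simp add: gr_def power2_eq_square)
        then show False using s(1) by simp
      qed
      moreover from this have "snd r = 0" using eq Z0 by simp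
      ultimately show "r = 0" by (simp add: prod_eq_iff)
    qed
    have zero: "f r = 0" if rQ: "r \<in> Q" for r
    proof -
      obtain s' t' where r: "r = (s', t')" "dist s' s0 < d" "chart_inv c (x s') = \<phi> t' p"
        using rQ unfolding Q_def by blast
      then have "chart_map c (\<phi> t' p) = x s'" using c x d(2) by (metis chart_map_inv)
      then show ?thesis by (simp add: f_def r(1))
    qed
    obtain T where T: "open T" "q \<in> T" "\<And>y. y \<in> T \<Longrightarrow> f y = 0 \<Longrightarrow> y = q"
      using isolated_zero_of_injective_derivative[OF df \<open>inj f'\<close> zero[OF \<open>q \<in> Q\<close>]] by blast
    have "T \<inter> Q = {q}"
    proof (intro equalityI subsetI)
      fix r assume "r \<in> T \<inter> Q"
      then show "r \<in> {q}" using T(3)[OF _ zero] by blast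
    qed (use T(2) \<open>q \<in> Q\<close> in blast)
    then show "\<exists>T. open T \<and> T \<inter> Q = {q}" using T(1) by blast
  qed
  then have "countable (fst ` Q)" by simp
  \<comment> \<open>Every time near \<open>s0\<close> occurs in a pair, because the geodesic lies in
    the orbit.\<close>
  moreover have "ball s0 d \<subseteq> fst ` Q"
  proof
    fix s assume "s \<in> ball s0 d"
    then have s: "dist s s0 < d" by (simp add: dist_commute)
    then obtain t where "chart_inv c (x s) = \<phi> t p" using orbit d(2) by blast
    then have "(s, t) \<in> Q" using s by (simp add: Q_def)
    then show "s \<in> fst ` Q" by force
  qed
  ultimately show False
    using uncountable_ball[OF d(1), of s0] countable_subset by blast
qed

end

context riemannian_manifold
begin

text \<open>Near time 0 the velocity is \<open>k s\<close> times the generator. Its derivative at 0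
  equals \<open>- \<Gamma>(a, a)\<close> by the geodesic equation, and the product rule turns this
  into the claim. The field of the overview is \<open>k\<close> times the \<open>Z\<close> obtained
  here.\<close>

lemma geodesic_vector_exists:
  assumes GO: "geodesic_orbit A g" and c: "c \<in> A" and p: "p \<in> chart_dom c" and a: "a \<noteq> 0"
  obtains Z k l where "Z \<in> killing_fields A g" "a = k *\<^sub>R Z p c"
    "k *\<^sub>R frechet_derivative (field_coord Z c) (at (chart_map c p)) a
      + christoffel A g c (chart_map c p) a a = l *\<^sub>R a"
proof -
  let ?x0 = "chart_map c p"
  obtain e \<gamma> x v where e: "e > 0" "geodesic A g {-e<..<e} \<gamma>" "x 0 = ?x0" "v 0 = a"
    and x: "\<And>t. \<bar>t\<bar> < e \<Longrightarrow> x t \<in> chart_image c \<and> \<gamma> t = chart_inv c (x t)"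
    and dx: "\<And>t. \<bar>t\<bar> < e \<Longrightarrow> (x has_vector_derivative v t) (at t)"
    and dv: "\<And>t. \<bar>t\<bar> < e \<Longrightarrow> (v has_vector_derivative - christoffel A g c (x t) (v t) (v t)) (at t)"
    using local_geodesic[OF c p, of a] by blast
  obtain J \<gamma>' where J: "maximal_geodesic A g J \<gamma>'" "{-e<..<e} \<subseteq> J" "\<And>t. t \<in> {-e<..<e} \<Longrightarrow> \<gamma>' t = \<gamma> t"
    using geodesic_extends_to_maximal[OF e(2)] by blast
  obtain \<phi> q where \<phi>: "one_parameter_subgroup A g \<phi>" "\<gamma>' ` J = range (\<lambda>t. \<phi> t q)"
    using GO J(1) unfolding geodesic_orbit_def by blast
  interpret isometric_flow A g \<phi>
    by unfold_locales (rule \<phi>(1))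
  have orbit: "\<exists>t. chart_inv c (x s) = \<phi> t q" if "\<bar>s\<bar> < e" for s
  proof -
    have "s \<in> {-e<..<e}" using that by auto
    then have "\<gamma> s \<in> \<gamma>' ` J" using J(2,3) by (metis image_eqI subsetD)
    then show ?thesis using \<phi>(2) x[OF that] by auto
  qed
  let ?Z = "field_coord generator c"
  have x0: "?x0 \<in> chart_image c" using p by simp
  have gp: "generator p c = ?Z ?x0" using c p by (simp add: field_coord_def)
  \<comment> \<open>If the generator vanished at \<open>p\<close>, the orbit would be the single
    point \<open>p\<close> and the geodesic constant, against \<open>a \<noteq> 0\<close>.\<close>
  have Z0: "?Z ?x0 \<noteq> 0"
  proof
    assume "?Z ?x0 = 0"
    then have fix_p: "\<phi> t p = p" for t using fixed_of_generator_zero[OF c p] gp by simp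
    obtain r where r: "p = \<phi> r q" using orbit[of 0] e c p by auto
    have "\<phi> t q = p" for t
      using fix_p[of "t - r"] unfolding r flow_add[symmetric] by simp
    then have "x s = ?x0" if "\<bar>s\<bar> < e" for s
      using orbit[OF that] x[OF that] c by (metis chart_map_inv)
    then have "((\<lambda>s. ?x0) has_vector_derivative a) (at 0)"
      using e has_vector_derivative_transform_within_open[OF dx[of 0], of "{-e<..<e}" "\<lambda>s. ?x0"]
      by (auto simp: abs_less_iff)
    then have "a = 0" using has_vector_derivative_const vector_derivative_unique_at by blast
    then show False using a by simp
  qed
  have Zd: "(?Z has_derivative frechet_derivative ?Z (at ?x0)) (at (x 0))"
    unfolding e(3) using generator_in_vector_fields c x0
    unfolding vector_fields_def by (blast intro: smooth_on_has_derivative)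
  define z where "z s = ?Z (x s)" for s
  let ?dz = "frechet_derivative ?Z (at ?x0) a"
  have dx0: "(x has_derivative (\<lambda>h. h *\<^sub>R a)) (at 0)"
    using dx[of 0] e by (simp add: has_vector_derivative_def)
  have "(z has_derivative (\<lambda>h. frechet_derivative ?Z (at ?x0) (h *\<^sub>R a))) (at 0)"
    unfolding z_def[abs_def] by (rule has_derivative_compose[where g = ?Z, OF dx0 Zd])
  then have dz: "(z has_vector_derivative ?dz) (at 0)"
    using linear_scale[OF has_derivative_linear[OF Zd]] by (simp add: has_vector_derivative_def)
  have z0: "z 0 = ?Z ?x0" by (simp add: z_def e(3))
  \<comment> \<open>The projection coefficient: defined for every \<open>s\<close>, and
    differentiable at 0 as a quotient.\<close>
  define k where "k s = (v s \<bullet> z s) / (z s \<bullet> z s)" for s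
  have dv0: "(v has_vector_derivative - christoffel A g c ?x0 a a) (at 0)"
    using dv[of 0] e by simp
  have "k differentiable (at 0)"
  proof -
    have "v differentiable (at 0)" "z differentiable (at 0)"
      using dv0 dz by (auto intro: differentiableI_vector)
    then show ?thesis
      unfolding k_def[abs_def] using Z0 z0
      by (intro differentiable_divide differentiable_inner) auto
  qed
  then obtain k' where k': "(k has_real_derivative k') (at 0)"
    using real_differentiable_def by blast
  have prod: "((\<lambda>s. k s *\<^sub>R z s) has_vector_derivative (k 0 *\<^sub>R ?dz + k' *\<^sub>R z 0)) (at 0)"
    by (rule has_vector_derivative_scaleR[OF k' dz])
  have "isCont z 0" using dz by (rule has_vector_derivative_continuous)
  then have "\<forall>\<^sub>F s in nhds 0. z s \<noteq> 0"
    unfolding isCont_def tendsto_at_iff_tendsto_nhds using Z0 z0 by (intro tendsto_imp_eventually_ne) auto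
  then obtain d where d: "d > 0" "\<And>s. \<bar>s\<bar> < d \<Longrightarrow> z s \<noteq> 0"
    unfolding eventually_nhds_metric by (auto simp: dist_real_def)
  have vk: "v s = k s *\<^sub>R z s" if "\<bar>s\<bar> < min d e" for s
  proof -
    have "(v s \<bullet> v s) * (z s \<bullet> z s) = (v s \<bullet> z s)\<^sup>2"
      unfolding z_def
    proof (rule geodesic_velocity_parallel_to_generator[OF c _ dx orbit])
      show "isCont v s" if "\<bar>s\<bar> < e" for s using dv[OF that] by (rule has_vector_derivative_continuous)
    qed (use x that in auto)
    then show ?thesis unfolding k_def using d(2)[of s] that by (intro parallel_of_gram_zero) auto
  qed
  have "(v has_vector_derivative (k 0 *\<^sub>R ?dz + k' *\<^sub>R z 0)) (at 0)"
  proof (rule has_vector_derivative_transform_within_open[OF prod])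
    show "k s *\<^sub>R z s = v s" if "s \<in> ball 0 (min d e)" for s
      using vk[of s] that by (simp add: dist_real_def)
  qed (use d e in auto)
  then have "- christoffel A g c ?x0 a a = k 0 *\<^sub>R ?dz + k' *\<^sub>R z 0"
    using dv0 vector_derivative_unique_at by blast
  then have eq: "k 0 *\<^sub>R ?dz + christoffel A g c ?x0 a a = - k' *\<^sub>R z 0"
    by (subst minus_minus[of "christoffel A g c ?x0 a a", symmetric]) simp
  have a0: "a = k 0 *\<^sub>R z 0" using vk[of 0] d e by simp
  then have "k 0 \<noteq> 0" using a by auto
  then have "z 0 = (1 / k 0) *\<^sub>R a" using a0 by simp
  \<comment> \<open>Thus \<open>l = - k' / k 0\<close>, the rate at which the two parametrisations
    drift apart.\<close>
  then have "k 0 *\<^sub>R ?dz + christoffel A g c ?x0 a a = (- k' / k 0) *\<^sub>R a"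
    using eq by simp
  moreover have "a = k 0 *\<^sub>R generator p c" using a0 unfolding z0 gp .
  ultimately show ?thesis
    using that[OF generator_killing] by blast
qed

end


section \<open>Killing fields in an abelian ideal\<close>

text \<open>
  Here \<open>D u w v\<close> stands for \<open>\<partial>\<^sub>v g(u, w)\<close>, the vectors \<open>a\<close> and \<open>b\<close> for the values of \<open>X\<close> and
  \<open>[Z, X]\<close>, and \<open>P\<close>, \<open>Q\<close>, \<open>R\<close> for the derivatives of \<open>X\<close>, \<open>Z\<close>, \<open>[Z, X]\<close> at a point where
  \<open>X = Z\<close>.
\<close>

lemma length_critical_of_geodesic_vector:
  fixes G :: "'e::real_vector \<Rightarrow> 'e \<Rightarrow> real"
  assumes G: "bilinear G" and sym: "\<And>u w. G u w = G w u" and pos: "\<And>u. u \<noteq> 0 \<Longrightarrow> G u u > 0"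
    and Dsym: "\<And>u w v. D u w v = D w u v"
    and KX: "\<And>u w. D u w a + G (P u) w + G u (P w) = 0"
    and KZ: "\<And>u w. D u w a + G (Q u) w + G u (Q w) = 0"
    and KY: "\<And>u w. D u w b + G (R u) w + G u (R w) = 0"
    and b: "b = P a - Q a" and com: "R a = P b"
    and geo: "\<And>w. G (Q a) w + D a w a - D a a w / 2 = l * G a w" and a: "a \<noteq> 0"
  shows "D a a u + G (P u) a + G a (P u) = 0"
proof -
  \<comment> \<open>With \<open>w = a\<close> the left side of \<open>geo\<close> is
    \<open>G (Q a) a + D a a a / 2\<close>, which is half of the Killing equation for
    \<open>Q\<close>.\<close>
  have "l * G a a = 0" using geo[of a] KZ[of a a] sym[of a "Q a"] by linarith
  then have "l = 0" using pos[OF a] by auto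
  then have Qa: "G (Q a) w = D a a w / 2 - D a w a" for w using geo[of w] by simp
  \<comment> \<open>Coordinate form of the two skewness steps with commutation in between:
    \<open>KX\<close> moves \<open>P\<close> onto \<open>b\<close>, \<open>com\<close> turns
    \<open>P b\<close> into \<open>R a\<close>, and \<open>KY\<close> evaluates the result.\<close>
  have "G (P a) b = - D a b a - G a (R a)" using KX[of a b] com by simp
  also have "G a (R a) = - D a a b / 2" using KY[of a a] sym[of a "R a"] by simp
  finally have "G (P a) b = G (Q a) b" unfolding Qa by simp
  then have "G b b = 0" by (subst b) (simp add: bilinear_lsub[OF G])
  then have "b = 0" using pos[of b] by (cases "b = 0") auto
  then have "P a = Q a" using b by simp
  then have "G u (P a) = D a a u / 2 - D a u a" using Qa[of u] sym[of u "Q a"] by simp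
  then show ?thesis using KX[of u a] Dsym[of u a a] sym[of a "P u"] by simp
qed

context riemannian_manifold
begin

lemma killing_field_in_vector_fields: "X \<in> killing_fields A g \<Longrightarrow> X \<in> vector_fields A"
  by (simp add: killing_fields_def)

lemma field_coord_has_derivative:
  assumes "X \<in> vector_fields A" "c \<in> A" "x \<in> chart_image c"
  shows "(field_coord X c has_derivative frechet_derivative (field_coord X c) (at x)) (at x)"
  using assms smooth_on_has_derivative unfolding vector_fields_def by blast

lemma killing_equation:
  assumes "X \<in> killing_fields A g" "c \<in> A" "x \<in> chart_image c"
  shows "D c x u w (field_coord X c x) + G c x (frechet_derivative (field_coord X c) (at x) u) w
     + G c x u (frechet_derivative (field_coord X c) (at x) w) = 0"
  using assms unfolding killing_fields_def D_def by blast

text \<open>The field \<open>Z\<close> and the factor \<open>k\<close> are chosen afresh at each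
  point; only their values and first derivatives there enter.\<close>

lemma length_has_derivative_zero:
  assumes GO: "geodesic_orbit A g" and ideal: "lie_ideal (lie_bracket A) (killing_fields A g) \<aa>"
    and abel: "lie_abelian (lie_bracket A) \<aa>" and X: "X \<in> \<aa>"
    and c: "c \<in> A" and x: "x \<in> chart_image c"
  shows "((\<lambda>y. G c y (field_coord X c y) (field_coord X c y)) has_derivative (\<lambda>h. 0)) (at x)"
proof -
  have KX: "X \<in> killing_fields A g" using ideal X unfolding lie_ideal_def by blast
  let ?p = "chart_inv c x"
  have p: "?p \<in> chart_dom c" "chart_map c ?p = x" using c x by auto
  let ?d = "\<lambda>X. frechet_derivative (field_coord X c) (at x)"
  let ?a = "field_coord X c x"
  note GB = metric_bilinear[OF c x]
  have X': "(field_coord X c has_derivative ?d X) (at x)"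
    by (rule field_coord_has_derivative[OF killing_field_in_vector_fields[OF KX] c x])
  have der: "((\<lambda>y. G c y (field_coord X c y) (field_coord X c y)) has_derivative
      (\<lambda>h. D c x ?a ?a h + G c x (?d X h) ?a + G c x ?a (?d X h))) (at x)"
    by (rule has_derivative_bilinear_form[OF open_chart_image[OF c] x metric_bilinear[OF c]
          metric_has_derivative[OF c x] has_derivative_ident X' X'])
  have "D c x ?a ?a h + G c x (?d X h) ?a + G c x ?a (?d X h) = 0" for h
  proof (cases "?a = 0")
    case True
    have "G c x 0 u = 0" "G c x u 0 = 0" "D c x 0 0 h = 0" for u
      using bilinear_lzero[OF GB] bilinear_rzero[OF GB] bilinear_lzero[OF D_bilinear[OF c x]] by auto
    then show ?thesis using True by simp
  next
    case False
    obtain Z k l where Z: "Z \<in> killing_fields A g" "?a = k *\<^sub>R Z ?p c"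
      and geo: "k *\<^sub>R ?d Z ?a + christoffel A g c x ?a ?a = l *\<^sub>R ?a"
      using geodesic_vector_exists[OF GO c p(1) False] p(2) by metis
    define Y where "Y = lie_bracket A Z X"
    have Y: "Y \<in> \<aa>" "Y \<in> killing_fields A g"
      using ideal X Z(1) unfolding Y_def lie_ideal_def by blast+
    have br: "lie_bracket A U V ?p c = ?d V (U ?p c) - ?d U (V ?p c)" for U V
      using c p by (simp add: lie_bracket_def)
    have Yc: "field_coord Y c x = ?d X (Z ?p c) - ?d Z ?a"
      by (simp add: field_coord_def Y_def br)
    have "lie_bracket A X Y = 0" using abel X Y(1) unfolding lie_abelian_def by blast
    then have "lie_bracket A X Y ?p c = 0" by (simp add: zero_fun_def)
    \<comment> \<open>At the point, \<open>[X, Y] = 0\<close> says that the derivative of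
      \<open>Y\<close> along \<open>X\<close> equals that of \<open>X\<close> along
      \<open>Y\<close>.\<close>
    then have com: "?d Y ?a = ?d X (field_coord Y c x)"
      unfolding br by (simp add: field_coord_def)
    have lX: "linear (?d X)" using X' has_derivative_linear by blast
    \<comment> \<open>The Killing equation of \<open>k\<close> times \<open>U\<close>, written at
      one point; it serves for both \<open>Z\<close> and \<open>Y\<close>, since \<open>k\<close>
      times \<open>Y\<close> is the bracket of the rescaled \<open>Z\<close> with
      \<open>X\<close>.\<close>
    have scaled: "D c x u w (k *\<^sub>R field_coord U c x) + G c x (k *\<^sub>R ?d U u) w + G c x u (k *\<^sub>R ?d U w) = 0"
      if "U \<in> killing_fields A g" for U u w
    proof -
      have "D c x u w (k *\<^sub>R field_coord U c x) + G c x (k *\<^sub>R ?d U u) w + G c x u (k *\<^sub>R ?d U w)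
        = k * (D c x u w (field_coord U c x) + G c x (?d U u) w + G c x u (?d U w))"
        by (simp add: linear_scale[OF D_linear[OF c x]] bilinear_lmul[OF GB] bilinear_rmul[OF GB] algebra_simps)
      then show ?thesis using killing_equation[OF that c x] by simp
    qed
    show ?thesis
    proof (rule length_critical_of_geodesic_vector[where G = "G c x" and D = "D c x" and P = "?d X"
          and Q = "\<lambda>u. k *\<^sub>R ?d Z u" and R = "\<lambda>u. k *\<^sub>R ?d Y u" and b = "k *\<^sub>R field_coord Y c x" and l = l])
      show "D c x u w ?a + G c x (?d X u) w + G c x u (?d X w) = 0" for u w
        by (rule killing_equation[OF KX c x])
      show "D c x u w ?a + G c x (k *\<^sub>R ?d Z u) w + G c x u (k *\<^sub>R ?d Z w) = 0" for u w
        using scaled[OF Z(1), of u w] Z(2) by (simp add: field_coord_def)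
      show "D c x u w (k *\<^sub>R field_coord Y c x) + G c x (k *\<^sub>R ?d Y u) w + G c x u (k *\<^sub>R ?d Y w) = 0" for u w
        by (rule scaled[OF Y(2)])
      have "?d X ?a = k *\<^sub>R ?d X (Z ?p c)" unfolding Z(2) by (rule linear_scale[OF lX])
      then show "k *\<^sub>R field_coord Y c x = ?d X ?a - k *\<^sub>R ?d Z ?a"
        unfolding Yc by (simp only: scaleR_diff_right)
      show "k *\<^sub>R ?d Y ?a = ?d X (k *\<^sub>R field_coord Y c x)"
        unfolding com by (rule linear_scale[OF lX, symmetric])
      show "G c x (k *\<^sub>R ?d Z ?a) w + D c x ?a w ?a - D c x ?a ?a w / 2 = l * G c x ?a w" for w
      proof -
        have "G c x (k *\<^sub>R ?d Z ?a) w + G c x (christoffel A g c x ?a ?a) w = l * G c x ?a w"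
          unfolding bilinear_ladd[OF GB, symmetric] geo by (simp add: bilinear_lmul[OF GB])
        then show ?thesis unfolding metric_christoffel[OF c x] by argo
      qed
    qed (use False GB metric_sym[OF c x] metric_pos[OF c x] D_sym[OF c x] in auto)
  qed
  then show ?thesis using der by simp
qed

end

theorem theorem1:
  fixes A :: "('m::{t2_space, second_countable_topology}, 'e::euclidean_space) chart set"
    and g :: "('m, 'e) metric"
    and \<aa> :: "('m \<Rightarrow> ('m, 'e) tvec) set"
    and X :: "'m \<Rightarrow> ('m, 'e) tvec"
  assumes "smooth_atlas A"
    and "riemannian_metric A g"
    and "connected (UNIV :: 'm set)"
    and "geodesic_orbit A g"
    and "lie_ideal (lie_bracket A) (killing_fields A g) \<aa>"
    and "lie_abelian (lie_bracket A) \<aa>"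
    and "X \<in> \<aa>"
  shows "(\<lambda>y. g y (X y) (X y)) constant_on UNIV"
proof -
  interpret riemannian_manifold A g
    by unfold_locales (rule assms)+
  have X: "X p \<in> tangent_space A p" for p
    using assms(5,7) unfolding lie_ideal_def killing_fields_def vector_fields_def by blast
  have "g p (X p) (X p) = g q (X q) (X q)" for p q
  \<comment> \<open>Connectedness reduces the claim to local constancy, which is read off on a
    coordinate ball around \<open>p\<close>.\<close>
  proof (rule connected_local_const[OF assms(3) UNIV_I UNIV_I, where f = "\<lambda>y. g y (X y) (X y)"], rule ballI)
    fix p :: 'm
    obtain c where c: "c \<in> A" "p \<in> chart_dom c" using chart_at .
    let ?f = "\<lambda>y. G c y (field_coord X c y) (field_coord X c y)"
    have f: "g q (X q) (X q) = ?f (chart_map c q)" if "q \<in> chart_dom c" for q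
      using metric_eq_coord[OF c(1) that X X] c(1) that by (simp add: field_coord_def)
    obtain r where r: "r > 0" "ball (chart_map c p) r \<subseteq> chart_image c"
      using open_chart_image[OF c(1)] chart_map_image[OF c(2)] open_contains_ball by blast
    have const: "?f (chart_map c p) = ?f y" if "y \<in> ball (chart_map c p) r" for y
    proof (rule has_derivative_zero_unique[OF convex_ball _ _ that])
      fix z assume "z \<in> ball (chart_map c p) r"
      then have "z \<in> chart_image c" using r(2) by blast
      from length_has_derivative_zero[OF assms(4-7) c(1) this]
      show "(?f has_derivative (\<lambda>h. 0)) (at z within ball (chart_map c p) r)"
        by (rule has_derivative_at_withinI)
    qed (use r in simp)
    have "\<forall>\<^sub>F q in at p. chart_map c q \<in> ball (chart_map c p) r"
      using isCont_chart_map[OF c] r(1) unfolding isCont_def by (intro topological_tendstoD) auto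
    moreover have "\<forall>\<^sub>F q in at p. q \<in> chart_dom c"
      using open_chart_dom[OF c(1)] c(2) by (intro eventually_at_in_open') auto
    ultimately show "\<forall>\<^sub>F q in at p. g p (X p) (X p) = g q (X q) (X q)"
    proof eventually_elim
      case (elim q)
      then show ?case using const f c(2) by simp
    qed
  qed
  then show ?thesis unfolding constant_on_def by blast
qed

end
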